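(* Let $p\ge3$ be a prime, let $a\in\mathbb{Z}_p$ satisfy conditions (1) and (2) of the context, and let $\sigma(t)=ct^p$ with $c\in1+pW$. Write $\widehat{G}^{(\sigma)}_{a,a;2a}(t)=\sum_{k\ge0}B_kt^k$. Then $B_k\in W$ for every $k\in\mathbb{Z}_{\ge0}$. Consequently, $\widehat{\mathscr{F}}^{(\sigma)}_{a,a;2a}(t)\in W[[t]]$.
   Context: $W=W(\overline{\mathbb{F}}_p)$ is the ring of Witt vectors, $F$ its Frobenius; $\sigma$ acts on $W[[t]]$ by $(\sum a_it^i)^\sigma=\sum a_i^F c^i t^{ip}$. Every $\alpha\in\mathbb{Z}_p$ is written $\alpha=-\sum_{i\ge0}[\alpha]_ip^i$ with $[\alpha]_i\in\{0,\dots,p-1\}$. The Dwork prime is $\alpha'=(\alpha+l_\alpha)/p$ with $l_\alpha\in\{0,\dots,p-1\}$, $\alpha+l_\alpha\equiv0\pmod p$. Conditions on $a$: (1) $a\in N^{-1}\mathbb{Z}$ for some integer $N\ge2$ with $p\nmid N$; (2) for every $i\ge0$, $[a]_i<[2a]_i$, i.e. $0<[a]_i\le (p-1)/2$. Let $l=l_a$. $F_{\alpha,\beta;\gamma}(t)=\sum_{n\ge0}\frac{(\alpha)_n(\beta)_n}{(1)_n(\gamma)_n}t^n$, $(\alpha)_n=\alpha(\alpha+1)\cdots(\alpha+n-1)$. $F_{a,a;2a}(t)$ and $F_{a',a';(2a)'}(t)$ lie in $\mathbb{Z}_p[[t]]$. $\Gamma_p$ is Morita's $p$-adic Gamma function and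 $B_p(x,y)=\Gamma_p(x)\Gamma_p(y)/\Gamma_p(x+y)\in\mathbb{Z}_p^\times$. Define $$\widehat{G}^{(\sigma)}_{a,a;2a}(t)=t^{-a}\int_0^t\Big(t^aF_{a,a;2a}(t)-(-1)^lB_p(a,a)^{-1}[t^{a'}F_{a',a';(2a)'}(t)]^\sigma\Big)\frac{dt}{t},\qquad \int_0^t t^\alpha\frac{dt}{t}=\frac{t^\alpha}\alpha\ (\alpha\ne0).$$ Explicitly, with $F_{a,a;2a}=\sum A_kt^k$, $F_{a',a';(2a)'}=\sum A^{(1)}_kt^k$: $B_k=\frac1{k+a}\big(A_k-(-1)^lB_p(a,a)^{-1}A^{(1)}_{(k-l)/p}c^{(k+a)/p}\big)$, where $A^{(1)}_{m/p}=0$ if $p\nmid m$ or $m<0$. Put $\widehat{\mathscr{F}}^{(\sigma)}_{a,a;2a}(t)=\widehat{G}^{(\sigma)}_{a,a;2a}(t)/F_{a,a;2a}(t)$. *)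

theory Defs
  imports
    "HOL-Algebra.Algebraic_Closure_Type"
    "Berlekamp_Zassenhaus.Finite_Field"
    "HOL-Library.Poly_Mapping"
    "HOL-Computational_Algebra.Computational_Algebra"
begin

hide_const (open) Divisibility.prime



section \<open>Integer polynomials in arbitrarily many variables\<close>

type_synonym 'v zpoly = "('v \<Rightarrow>\<^sub>0 nat) \<Rightarrow>\<^sub>0 int"

definition zvar :: "'v \<Rightarrow> 'v zpoly" where
  "zvar v = Poly_Mapping.single (Poly_Mapping.single v 1) 1"

definition zmonom :: "('v \<Rightarrow> 'a::comm_ring_1) \<Rightarrow> ('v \<Rightarrow>\<^sub>0 nat) \<Rightarrow> 'a" where
  "zmonom f m = (\<Prod>v\<in>Poly_Mapping.keys m. f v ^ Poly_Mapping.lookup m v)"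

text \<open>The value of $P \in \mathbb Z[X_v]_v$ at $X_v = f(v)$.\<close>

definition zeval :: "('v \<Rightarrow> 'a::comm_ring_1) \<Rightarrow> 'v zpoly \<Rightarrow> 'a" where
  "zeval f P = (\<Sum>m\<in>Poly_Mapping.keys P. of_int (Poly_Mapping.lookup P m) * zmonom f m)"

lemma zmonom_superset:
  assumes "finite S" "Poly_Mapping.keys m \<subseteq> S"
  shows "zmonom f m = (\<Prod>v\<in>S. f v ^ Poly_Mapping.lookup m v)"
  unfolding zmonom_def using assms
  by (intro prod.mono_neutral_left) (auto simp: in_keys_iff)

lemma zmonom_0 [simp]: "zmonom f 0 = 1"
  by (simp add: zmonom_def)

lemma zmonom_add: "zmonom f (m + n) = zmonom f m * zmonom f n"
proof -
  define S where "S = Poly_Mapping.keys m \<union> Poly_Mapping.keys n"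
  have S: "finite S" "Poly_Mapping.keys m \<subseteq> S" "Poly_Mapping.keys n \<subseteq> S"
    "Poly_Mapping.keys (m + n) \<subseteq> S"
    using keys_add[of m n] by (auto simp: S_def)
  show ?thesis
    using S by (simp add: zmonom_superset[of S] lookup_add power_add prod.distrib)
qed

lemma zmonom_single: "zmonom f (Poly_Mapping.single v k) = f v ^ k"
  by (subst zmonom_superset[of "{v}"]) auto

lemma zeval_superset:
  assumes "finite S" "Poly_Mapping.keys P \<subseteq> S"
  shows "zeval f P = (\<Sum>m\<in>S. of_int (Poly_Mapping.lookup P m) * zmonom f m)"
  unfolding zeval_def using assms
  by (intro sum.mono_neutral_left) (auto simp: in_keys_iff)

lemma zeval_0 [simp]: "zeval f 0 = 0"
  by (simp add: zeval_def)

lemma zeval_single: "zeval f (Poly_Mapping.single m c) = of_int c * zmonom f m"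
  by (subst zeval_superset[of "{m}"]) auto

lemma zeval_1 [simp]: "zeval f 1 = 1"
  using zeval_single[of f 0 1] by simp

lemma zeval_zvar [simp]: "zeval f (zvar v) = f v"
  by (simp add: zvar_def zeval_single zmonom_single)

lemma zeval_add [simp]: "zeval f (P + Q) = zeval f P + zeval f Q"
proof -
  define S where "S = Poly_Mapping.keys P \<union> Poly_Mapping.keys Q"
  have S: "finite S" "Poly_Mapping.keys P \<subseteq> S" "Poly_Mapping.keys Q \<subseteq> S"
    "Poly_Mapping.keys (P + Q) \<subseteq> S"
    using keys_add[of P Q] by (auto simp: S_def)
  show ?thesis
    using S by (simp add: zeval_superset[of S] lookup_add sum.distrib algebra_simps)
qed

lemma zpoly_induct_single:
  fixes Q :: "'v zpoly \<Rightarrow> bool"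
  assumes "Q 0" "\<And>m c. Q (Poly_Mapping.single m c)" "\<And>P R. Q P \<Longrightarrow> Q R \<Longrightarrow> Q (P + R)"
  shows "Q P"
proof (induction P rule: Poly_Mapping.update_induct)
  case const
  show ?case by (rule assms)
next
  case (update f a b)
  have "Poly_Mapping.update a b f = f + Poly_Mapping.single a b"
    using update(1)
    by (intro poly_mapping_eqI) (auto simp: lookup_update lookup_add lookup_single in_keys_iff when_def)
  with assms update show ?case by simp
qed

lemma zeval_mult [simp]: "zeval f (P * Q) = zeval f P * zeval f Q"
proof (induction P rule: zpoly_induct_single)
  case (2 m c)
  show ?case
    by (induction Q rule: zpoly_induct_single)
       (simp_all add: mult_single zeval_single zmonom_add algebra_simps)
qed (simp_all add: algebra_simps)

lemma zeval_power [simp]: "zeval f (P ^ n) = zeval f P ^ n"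
  by (induction n) simp_all

lemma zeval_uminus [simp]: "zeval f (- P) = - zeval f P"
  using zeval_add[of f P "- P"] by (simp add: eq_neg_iff_add_eq_0 add.commute)

lemma zeval_diff [simp]: "zeval f (P - Q) = zeval f P - zeval f Q"
  using zeval_add[of f P "- Q"] by simp

lemma zeval_sum [simp]: "zeval f (sum g A) = (\<Sum>x\<in>A. zeval f (g x))"
  by (induction A rule: infinite_finite_induct) simp_all

lemma zeval_of_nat [simp]: "zeval f (of_nat n) = of_nat n"
  by (induction n) simp_all

lemma zeval_of_int [simp]: "zeval f (of_int n) = of_int n"
  by (cases n) simp_all

lemma zpoly_induct [case_names const var add mult]:
  fixes Q :: "'v zpoly \<Rightarrow> bool"
  assumes "\<And>c. Q (of_int c)" "\<And>v. Q (zvar v)"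
    "\<And>P R. Q P \<Longrightarrow> Q R \<Longrightarrow> Q (P + R)" "\<And>P R. Q P \<Longrightarrow> Q R \<Longrightarrow> Q (P * R)"
  shows "Q P"
proof (induction P rule: zpoly_induct_single)
  case 1
  show ?case using assms(1)[of 0] by simp
next
  case (2 m c)
  have var_pow: "Q (Poly_Mapping.single (Poly_Mapping.single v k) 1)" for v k
  proof (induction k)
    case 0
    then show ?case using assms(1)[of 1] by simp
  next
    case (Suc k)
    have "Poly_Mapping.single (Poly_Mapping.single v (Suc k)) 1 =
        (zvar v * Poly_Mapping.single (Poly_Mapping.single v k) 1 :: 'v zpoly)"
      by (simp add: zvar_def mult_single flip: single_add)
    with Suc assms(2,4) show ?case by simp
  qed
  have "Q (Poly_Mapping.single m 1)"
  proof (induction m rule: Poly_Mapping.update_induct)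
    case const
    then show ?case using assms(1)[of 1] by simp
  next
    case (update m v k)
    have "Poly_Mapping.update v k m = m + Poly_Mapping.single v k"
      using update(1)
      by (intro poly_mapping_eqI) (auto simp: lookup_update lookup_add lookup_single in_keys_iff when_def)
    hence "Poly_Mapping.single (Poly_Mapping.update v k m) 1 =
        (Poly_Mapping.single m 1 * Poly_Mapping.single (Poly_Mapping.single v k) 1 :: 'v zpoly)"
      by (simp add: mult_single)
    with update var_pow assms(4) show ?case by simp
  qed
  moreover have "Poly_Mapping.single m c = (of_int c * Poly_Mapping.single m 1 :: 'v zpoly)"
    by (simp add: mult_single flip: single_of_int)
  ultimately show ?case using assms(1,4) by simp
qed (use assms in auto)

lemma zeval_hom:
  fixes h :: "'a::comm_ring_1 \<Rightarrow> 'b::comm_ring_1"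
  assumes "h 1 = 1" "\<And>x y. h (x + y) = h x + h y" "\<And>x y. h (x * y) = h x * h y"
  shows "h (zeval f P) = zeval (h \<circ> f) P"
proof (induction P rule: zpoly_induct)
  case (const c)
  have h0: "h 0 = 0" using assms(2)[of 0 0] by simp
  have hm: "h (- x) = - h x" for x using assms(2)[of x "-x"] h0
    by (simp add: eq_neg_iff_add_eq_0 add.commute)
  have hn: "h (of_nat n) = of_nat n" for n by (induction n) (simp_all add: h0 assms)
  show ?case by (cases c rule: int_cases2) (simp_all add: hn hm)
qed (simp_all add: assms)

lemma zeval_zeval: "zeval f (zeval g P) = zeval (zeval f \<circ> g) P"
  by (rule zeval_hom) simp_all

lemma zpoly_of_nat_cancel:
  fixes P :: "'v zpoly"
  assumes "of_nat n * P = of_nat n * Q" "n > 0"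
  shows "P = Q"
proof (rule poly_mapping_eqI)
  fix m
  have *: "Poly_Mapping.lookup (of_nat n * R) m = int n * Poly_Mapping.lookup R m" for R :: "'v zpoly"
    by (induction n) (simp_all add: algebra_simps lookup_add)
  show "Poly_Mapping.lookup P m = Poly_Mapping.lookup Q m"
    using *[of P] *[of Q] assms by simp
qed

section \<open>Ghost components\<close>

text \<open>The ghost component $w_n = \sum_{i \le n} p^i x_i^{p^{n-i}}$.\<close>

definition ghost :: "nat \<Rightarrow> (nat \<Rightarrow> 'a::comm_ring_1) \<Rightarrow> nat \<Rightarrow> 'a" where
  "ghost p x n = (\<Sum>i\<le>n. of_nat p ^ i * x i ^ (p ^ (n - i)))"

lemma ghost_zeval: "ghost p (zeval f \<circ> x) n = zeval f (ghost p x n)"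
  by (simp add: ghost_def flip: of_nat_power)

lemma ghost_split: "ghost p x n = (\<Sum>i<n. of_nat p ^ i * x i ^ (p ^ (n - i))) + of_nat p ^ n * x n"
  by (simp add: ghost_def flip: lessThan_Suc_atMost)

lemma dvd_power_lift:
  fixes x y :: "'a::comm_ring_1"
  assumes "k > 0" "of_nat p ^ k dvd x - y"
  shows "of_nat p ^ (k + n) dvd x ^ (p ^ n) - y ^ (p ^ n)"
proof (induction n)
  case 0
  with assms show ?case by simp
next
  case (Suc n)
  define u v where "u = x ^ (p ^ n)" and "v = y ^ (p ^ n)"
  have "of_nat p dvd u - v"
  proof -
    have "(of_nat p :: 'a) ^ 1 dvd of_nat p ^ (k + n)" using assms(1) by (intro le_imp_power_dvd) auto
    with Suc show ?thesis unfolding u_def v_def by (metis dvd_trans power_one_right)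
  qed
  then obtain w where w: "u = v + of_nat p * w"
    by (metis add.commute diff_add_cancel dvdE)
  have "of_nat p dvd (\<Sum>i<p. v ^ (p - Suc i) * u ^ i) - (\<Sum>i<p. v ^ (p - Suc i) * v ^ i)"
    unfolding sum_subtractf[symmetric]
  proof (intro dvd_sum)
    fix i
    have "u - v dvd u ^ i - v ^ i" by (simp add: power_diff_sumr2)
    moreover have "of_nat p dvd u - v" using w by simp
    ultimately have "of_nat p dvd u ^ i - v ^ i" by (rule dvd_trans[rotated])
    thus "of_nat p dvd v ^ (p - Suc i) * u ^ i - v ^ (p - Suc i) * v ^ i"
      by (simp flip: right_diff_distrib)
  qed
  moreover have "(\<Sum>i<p. v ^ (p - Suc i) * v ^ i) = of_nat p * v ^ (p - 1)"
  proof -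
    have "(\<Sum>i<p. v ^ (p - Suc i) * v ^ i) = (\<Sum>i<p. v ^ (p - 1))"
      by (intro sum.cong) (auto simp flip: power_add)
    thus ?thesis by simp
  qed
  ultimately have "of_nat p dvd ((\<Sum>i<p. v ^ (p - Suc i) * u ^ i) - of_nat p * v ^ (p - 1)) + of_nat p * v ^ (p - 1)"
    by (intro dvd_add) simp_all
  hence "of_nat p dvd (\<Sum>i<p. v ^ (p - Suc i) * u ^ i)" by simp
  moreover have "of_nat p ^ (k + n) dvd u - v" using Suc by (simp add: u_def v_def)
  ultimately have "of_nat p ^ (k + n) * of_nat p dvd (u - v) * (\<Sum>i<p. v ^ (p - Suc i) * u ^ i)"
    by (rule mult_dvd_mono[rotated])
  also have "\<dots> = u ^ p - v ^ p" by (simp add: power_diff_sumr2)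
  finally show ?case
    by (simp add: u_def v_def mult.commute flip: power_mult)
qed

lemma dvd_power_add:
  fixes x y :: "'a::comm_ring_1"
  assumes "prime p"
  shows "of_nat p dvd (x + y) ^ p - (x ^ p + y ^ p)"
proof -
  have p: "p > 0" using assms prime_gt_0_nat by blast
  have "(x + y) ^ p = (\<Sum>k\<le>p. of_nat (p choose k) * x ^ k * y ^ (p - k))"
    by (rule binomial_ring)
  also have "\<dots> = (\<Sum>k\<in>{..p} - {0,p}. of_nat (p choose k) * x ^ k * y ^ (p - k))
     + (\<Sum>k\<in>{0,p}. of_nat (p choose k) * x ^ k * y ^ (p - k))"
    by (rule sum.subset_diff) auto
  also have "(\<Sum>k\<in>{0,p}. of_nat (p choose k) * x ^ k * y ^ (p - k)) = x ^ p + y ^ p"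
    using p by simp
  finally have *: "(x + y) ^ p - (x ^ p + y ^ p) =
    (\<Sum>k\<in>{..p} - {0,p}. of_nat (p choose k) * x ^ k * y ^ (p - k))" by simp
  show ?thesis unfolding *
  proof (intro dvd_sum)
    fix k assume k: "k \<in> {..p} - {0,p}"
    have "p dvd (p choose k)"
      by (rule dvd_choose_prime) (use k assms in auto)
    then obtain j where "p choose k = p * j" by (elim dvdE)
    thus "of_nat p dvd of_nat (p choose k) * x ^ k * y ^ (p - k)"
      by (simp add: mult.assoc)
  qed
qed

text \<open>The lift of Frobenius $X_v \mapsto X_v^p$ on $\mathbb Z[X_v]_v$.\<close>

definition zfrob :: "nat \<Rightarrow> 'v zpoly \<Rightarrow> 'v zpoly" where
  "zfrob p = zeval (\<lambda>v. zvar v ^ p)"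

lemma zfrob_simps [simp]:
  "zfrob p (P + Q) = zfrob p P + zfrob p Q" "zfrob p (P * Q) = zfrob p P * zfrob p Q"
  "zfrob p (P - Q) = zfrob p P - zfrob p Q"
  "zfrob p (- P) = - zfrob p P" "zfrob p (P ^ n) = zfrob p P ^ n"
  "zfrob p (of_nat k) = of_nat k" "zfrob p (sum g A) = (\<Sum>x\<in>A. zfrob p (g x))"
  "zfrob p (zvar v) = zvar v ^ p" "zfrob p 0 = 0" "zfrob p 1 = 1"
  by (simp_all add: zfrob_def)

lemma fermat_int:
  assumes "prime p"
  shows "int p dvd c - c ^ p"
proof -
  have nat: "int p dvd int n - int n ^ p" for n
  proof (induction n)
    case 0
    then show ?case using prime_gt_0_nat[OF assms] by (simp add: power_0_left)
  next
    case (Suc n)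
    have "int p dvd (int n + 1) ^ p - (int n ^ p + 1 ^ p)"
      using dvd_power_add[OF assms, of "int n" 1] by simp
    with Suc have "int p dvd (int n - int n ^ p) - ((int n + 1) ^ p - (int n ^ p + 1 ^ p))"
      by (rule dvd_diff)
    thus ?case by (simp add: algebra_simps)
  qed
  define n where "n = nat (c mod int p)"
  have p: "p > 0" using assms prime_gt_0_nat by blast
  have c: "int p dvd c - int n"
    using p by (simp add: n_def mod_eq_dvd_iff flip: mod_eq_dvd_iff)
  have "c - int n dvd c ^ p - int n ^ p" by (simp add: power_diff_sumr2)
  with c have "int p dvd c ^ p - int n ^ p" by (rule dvd_trans)
  hence "int p dvd (c - int n) - (c ^ p - int n ^ p) + (int n - int n ^ p)"
    using dvd_add[OF dvd_diff[OF c] nat] by blast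
  thus ?thesis by (simp add: algebra_simps)
qed

lemma zfrob_cong:
  assumes "prime p"
  shows "of_nat p dvd zfrob p P - P ^ p"
proof (induction P rule: zpoly_induct)
  case (const c)
  have "(of_int (int p) :: 'a zpoly) dvd of_int (c - c ^ p)"
    using fermat_int[OF assms, of c] by (metis dvdE dvd_triv_left of_int_mult)
  thus ?case by (simp add: zfrob_def)
next
  case (var v)
  show ?case by simp
next
  case (add P R)
  have "of_nat p dvd (zfrob p P - P ^ p) + (zfrob p R - R ^ p) - ((P + R) ^ p - (P ^ p + R ^ p))"
    by (intro dvd_diff dvd_add add dvd_power_add assms)
  thus ?case by (simp add: algebra_simps)
next
  case (mult P R)
  have "of_nat p dvd (zfrob p P - P ^ p) * zfrob p R + P ^ p * (zfrob p R - R ^ p)"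
    by (intro dvd_add dvd_mult dvd_mult2 mult)
  thus ?case by (simp add: algebra_simps power_mult_distrib)
qed

text \<open>Dwork's criterion for a sequence of polynomials to be the ghost components of a Witt vector.\<close>

definition dwork_seq :: "nat \<Rightarrow> (nat \<Rightarrow> 'v zpoly) \<Rightarrow> bool" where
  "dwork_seq p w \<longleftrightarrow> (\<forall>n. of_nat p ^ Suc n dvd w (Suc n) - zfrob p (w n))"

lemma ghost_zfrob_cong:
  assumes "prime p"
  shows "of_nat p ^ Suc n dvd (\<Sum>i<Suc n. of_nat p ^ i * s i ^ (p ^ (Suc n - i))) - zfrob p (ghost p s n)"
proof -
  have *: "(\<Sum>i<Suc n. of_nat p ^ i * s i ^ (p ^ (Suc n - i))) - zfrob p (ghost p s n) =
    (\<Sum>i\<le>n. of_nat p ^ i * ((s i ^ p) ^ (p ^ (n - i)) - zfrob p (s i) ^ (p ^ (n - i))))"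
    unfolding ghost_def lessThan_Suc_atMost
    by (simp add: right_diff_distrib sum_subtractf Suc_diff_le flip: of_nat_power power_mult)
  show ?thesis unfolding *
  proof (intro dvd_sum)
    fix i assume i: "i \<in> {..n}"
    have "of_nat p ^ 1 dvd s i ^ p - zfrob p (s i)"
      using zfrob_cong[OF assms, of "s i"] by (metis dvd_minus_iff minus_diff_eq power_one_right)
    hence "of_nat p ^ (1 + (n - i)) dvd (s i ^ p) ^ (p ^ (n - i)) - zfrob p (s i) ^ (p ^ (n - i))"
      by (intro dvd_power_lift) auto
    hence "of_nat p ^ i * of_nat p ^ (1 + (n - i)) dvd
       of_nat p ^ i * ((s i ^ p) ^ (p ^ (n - i)) - zfrob p (s i) ^ (p ^ (n - i)))"
      by (rule mult_dvd_mono[OF dvd_refl])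
    moreover have "i + (1 + (n - i)) = Suc n" using i by simp
    ultimately show "of_nat p ^ Suc n dvd
       of_nat p ^ i * ((s i ^ p) ^ (p ^ (n - i)) - zfrob p (s i) ^ (p ^ (n - i)))"
      by (metis power_add)
  qed
qed

lemma dwork_seq_ghost:
  assumes "prime p"
  shows "dwork_seq p (ghost p s)"
  unfolding dwork_seq_def
proof
  fix n
  have "of_nat p ^ Suc n dvd ((\<Sum>i<Suc n. of_nat p ^ i * s i ^ (p ^ (Suc n - i))) - zfrob p (ghost p s n))
     + of_nat p ^ Suc n * s (Suc n)"
    by (intro dvd_add ghost_zfrob_cong assms) simp
  thus "of_nat p ^ Suc n dvd ghost p s (Suc n) - zfrob p (ghost p s n)"
    by (simp only: ghost_split[of p s "Suc n"] algebra_simps)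
qed

lemma dwork_seq_add: "dwork_seq p w \<Longrightarrow> dwork_seq p z \<Longrightarrow> dwork_seq p (\<lambda>n. w n + z n)"
  unfolding dwork_seq_def zfrob_simps add_diff_add by (blast intro: dvd_add)

lemma dwork_seq_uminus: "dwork_seq p w \<Longrightarrow> dwork_seq p (\<lambda>n. - w n)"
  unfolding dwork_seq_def zfrob_simps minus_diff_minus dvd_minus_iff by assumption

lemma dwork_seq_mult:
  assumes "dwork_seq p w" "dwork_seq p z"
  shows "dwork_seq p (\<lambda>n. w n * z n)"
  unfolding dwork_seq_def
proof
  fix n
  have "of_nat p ^ Suc n dvd (w (Suc n) - zfrob p (w n)) * z (Suc n)
    + zfrob p (w n) * (z (Suc n) - zfrob p (z n))"
    using assms unfolding dwork_seq_def by (intro dvd_add dvd_mult dvd_mult2) auto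
  thus "of_nat p ^ Suc n dvd w (Suc n) * z (Suc n) - zfrob p (w n * z n)"
    by (simp add: algebra_simps)
qed

fun unghost :: "nat \<Rightarrow> (nat \<Rightarrow> 'v zpoly) \<Rightarrow> nat \<Rightarrow> 'v zpoly" where
  "unghost p w n = (SOME z. of_nat p ^ n * z =
     w n - (\<Sum>i<n. of_nat p ^ i * unghost p w i ^ (p ^ (n - i))))"

declare unghost.simps [simp del]

lemma ghost_unghost:
  assumes "prime p" "dwork_seq p w"
  shows "ghost p (unghost p w) n = w n"
proof (induction n rule: less_induct)
  case (less n)
  have "of_nat p ^ n dvd w n - (\<Sum>i<n. of_nat p ^ i * unghost p w i ^ (p ^ (n - i)))"
  proof (cases n)
    case (Suc m)
    have "of_nat p ^ Suc m dvd (w (Suc m) - zfrob p (w m)) -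
      ((\<Sum>i<Suc m. of_nat p ^ i * unghost p w i ^ (p ^ (Suc m - i))) - zfrob p (ghost p (unghost p w) m))"
      by (rule dvd_diff[OF _ ghost_zfrob_cong[OF assms(1)]]) (use assms(2) dwork_seq_def in blast)
    also have "ghost p (unghost p w) m = w m" using less Suc by simp
    finally show ?thesis by (simp add: Suc del: sum.lessThan_Suc power_Suc)
  qed simp
  then obtain z where "w n - (\<Sum>i<n. of_nat p ^ i * unghost p w i ^ (p ^ (n - i))) = of_nat p ^ n * z"
    by (elim dvdE)
  from this[symmetric] have "of_nat p ^ n * unghost p w n = w n - (\<Sum>i<n. of_nat p ^ i * unghost p w i ^ (p ^ (n - i)))"
    unfolding unghost.simps[of p w n] by (rule someI)
  thus ?case by (simp add: ghost_split)
qed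

lemma ghost_cong_imp_cong:
  fixes s t :: "nat \<Rightarrow> 'v zpoly"
  assumes "prime p" "\<And>n. of_nat p ^ (k + n) dvd ghost p s n - ghost p t n" "k > 0"
  shows "of_nat p ^ k dvd s n - t n"
proof (induction n rule: less_induct)
  case (less n)
  have "of_nat p ^ (k + n) dvd (\<Sum>i<n. of_nat p ^ i * (s i ^ (p ^ (n - i)) - t i ^ (p ^ (n - i))))"
  proof (intro dvd_sum)
    fix i assume i: "i \<in> {..<n}"
    have "of_nat p ^ (k + (n - i)) dvd s i ^ (p ^ (n - i)) - t i ^ (p ^ (n - i))"
      using less i assms(3) by (intro dvd_power_lift) auto
    hence "of_nat p ^ i * of_nat p ^ (k + (n - i)) dvd
       of_nat p ^ i * (s i ^ (p ^ (n - i)) - t i ^ (p ^ (n - i)))"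
      by (rule mult_dvd_mono[OF dvd_refl])
    moreover have "i + (k + (n - i)) = k + n" using i by simp
    ultimately show "of_nat p ^ (k + n) dvd of_nat p ^ i * (s i ^ (p ^ (n - i)) - t i ^ (p ^ (n - i)))"
      by (metis power_add)
  qed
  with assms(2)[of n] have "of_nat p ^ (k + n) dvd (ghost p s n - ghost p t n) -
     (\<Sum>i<n. of_nat p ^ i * (s i ^ (p ^ (n - i)) - t i ^ (p ^ (n - i))))"
    by (rule dvd_diff)
  also have "\<dots> = of_nat p ^ n * (s n - t n)"
    by (simp add: ghost_split right_diff_distrib sum_subtractf)
  finally obtain z where "of_nat p ^ n * (s n - t n) = of_nat p ^ (k + n) * z"
    by (elim dvdE)
  hence "of_nat (p ^ n) * (s n - t n) = of_nat (p ^ n) * (of_nat p ^ k * z)"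
    by (simp add: power_add mult_ac)
  moreover have "p ^ n > 0" using prime_gt_0_nat[OF assms(1)] by simp
  ultimately have "s n - t n = of_nat p ^ k * z" by (rule zpoly_of_nat_cancel)
  thus ?case by simp
qed

lemma ghost_inj:
  fixes s t :: "nat \<Rightarrow> 'v zpoly"
  assumes "prime p" "\<And>n. ghost p s n = ghost p t n"
  shows "s = t"
proof
  fix n
  show "s n = t n"
  proof (induction n rule: less_induct)
    case (less n)
    hence "(\<Sum>i<n. of_nat p ^ i * s i ^ (p ^ (n - i))) = (\<Sum>i<n. of_nat p ^ i * t i ^ (p ^ (n - i)))"
      by (intro sum.cong) auto
    with assms(2)[of n] have "of_nat (p ^ n) * s n = of_nat (p ^ n) * t n"
      by (simp add: ghost_split of_nat_power)
    moreover have "p ^ n > 0" using prime_gt_0_nat[OF assms(1)] by simp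
    ultimately show ?case by (rule zpoly_of_nat_cancel)
  qed
qed



section \<open>Witt vectors\<close>

text \<open>
  The universal polynomials for sum, product and negative: the unique integer polynomials whose
  ghost components are the sum, product and negative of those of the generic Witt vectors.
  The variables of the two operands are indexed by \<^term>\<open>Inl i\<close> and \<^term>\<open>Inr i\<close>.
\<close>

definition witt_sum_poly :: "nat \<Rightarrow> nat \<Rightarrow> (nat + nat) zpoly" where
  "witt_sum_poly p = (THE S. \<forall>n. ghost p S n =
     ghost p (\<lambda>i. zvar (Inl i)) n + ghost p (\<lambda>i. zvar (Inr i)) n)"

definition witt_prod_poly :: "nat \<Rightarrow> nat \<Rightarrow> (nat + nat) zpoly" where
  "witt_prod_poly p = (THE S. \<forall>n. ghost p S n =
     ghost p (\<lambda>i. zvar (Inl i)) n * ghost p (\<lambda>i. zvar (Inr i)) n)"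

definition witt_neg_poly :: "nat \<Rightarrow> nat \<Rightarrow> nat zpoly" where
  "witt_neg_poly p = (THE S. \<forall>n. ghost p S n = - ghost p zvar n)"

lemma ghost_ex1:
  assumes "prime p" "dwork_seq p w"
  shows "\<exists>!S. \<forall>n. ghost p S n = w n"
  using ghost_unghost[OF assms] ghost_inj[OF assms(1)] by metis

lemma ghost_witt_polys:
  assumes "prime p"
  shows "ghost p (witt_sum_poly p) n = ghost p (\<lambda>i. zvar (Inl i)) n + ghost p (\<lambda>i. zvar (Inr i)) n"
    and "ghost p (witt_prod_poly p) n = ghost p (\<lambda>i. zvar (Inl i)) n * ghost p (\<lambda>i. zvar (Inr i)) n"
    and "ghost p (witt_neg_poly p) n = - ghost p zvar n"
proof -
  have D: "dwork_seq p (ghost p s)" for s :: "nat \<Rightarrow> 'b zpoly"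
    by (rule dwork_seq_ghost[OF assms])
  show "ghost p (witt_sum_poly p) n = ghost p (\<lambda>i. zvar (Inl i)) n + ghost p (\<lambda>i. zvar (Inr i)) n"
    using theI'[OF ghost_ex1[OF assms dwork_seq_add[OF D D]]] unfolding witt_sum_poly_def by blast
  show "ghost p (witt_prod_poly p) n = ghost p (\<lambda>i. zvar (Inl i)) n * ghost p (\<lambda>i. zvar (Inr i)) n"
    using theI'[OF ghost_ex1[OF assms dwork_seq_mult[OF D D]]] unfolding witt_prod_poly_def by blast
  show "ghost p (witt_neg_poly p) n = - ghost p zvar n"
    using theI'[OF ghost_ex1[OF assms dwork_seq_uminus[OF D]]] unfolding witt_neg_poly_def by blast
qed

definition wadd :: "nat \<Rightarrow> (nat \<Rightarrow> 'a::comm_ring_1) \<Rightarrow> (nat \<Rightarrow> 'a) \<Rightarrow> nat \<Rightarrow> 'a" where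
  "wadd p x y n = zeval (case_sum x y) (witt_sum_poly p n)"

definition wmult :: "nat \<Rightarrow> (nat \<Rightarrow> 'a::comm_ring_1) \<Rightarrow> (nat \<Rightarrow> 'a) \<Rightarrow> nat \<Rightarrow> 'a" where
  "wmult p x y n = zeval (case_sum x y) (witt_prod_poly p n)"

definition wneg :: "nat \<Rightarrow> (nat \<Rightarrow> 'a::comm_ring_1) \<Rightarrow> nat \<Rightarrow> 'a" where
  "wneg p x n = zeval x (witt_neg_poly p n)"

definition wone :: "nat \<Rightarrow> 'a::comm_ring_1" where
  "wone n = (if n = 0 then 1 else 0)"

lemma ghost_zeval': "ghost p (\<lambda>n. zeval f (x n)) n = zeval f (ghost p x n)"
  using ghost_zeval[of p f x n] by (simp add: o_def)

lemma zeval_ghost_zvar: "zeval f (ghost p (\<lambda>i. zvar (g i)) n) = ghost p (\<lambda>i. f (g i)) n"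
  by (simp flip: ghost_zeval')

lemma ghost_wadd:
  assumes "prime p"
  shows "ghost p (wadd p x y) n = ghost p x n + ghost p y n"
proof -
  have "wadd p x y = (\<lambda>n. zeval (case_sum x y) (witt_sum_poly p n))"
    by (simp add: wadd_def fun_eq_iff)
  thus ?thesis
    by (simp add: ghost_zeval' ghost_witt_polys[OF assms] zeval_ghost_zvar
        zeval_ghost_zvar[where g = "\<lambda>i. i"])
qed

lemma ghost_wmult:
  assumes "prime p"
  shows "ghost p (wmult p x y) n = ghost p x n * ghost p y n"
proof -
  have "wmult p x y = (\<lambda>n. zeval (case_sum x y) (witt_prod_poly p n))"
    by (simp add: wmult_def fun_eq_iff)
  thus ?thesis
    by (simp add: ghost_zeval' ghost_witt_polys[OF assms] zeval_ghost_zvar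
        zeval_ghost_zvar[where g = "\<lambda>i. i"])
qed

lemma ghost_wneg:
  assumes "prime p"
  shows "ghost p (wneg p x) n = - ghost p x n"
proof -
  have "wneg p x = (\<lambda>n. zeval x (witt_neg_poly p n))"
    by (simp add: wneg_def fun_eq_iff)
  thus ?thesis
    by (simp add: ghost_zeval' ghost_witt_polys[OF assms] zeval_ghost_zvar
        zeval_ghost_zvar[where g = "\<lambda>i. i"])
qed

lemma ghost_0:
  assumes "prime p"
  shows "ghost p (\<lambda>_. 0) n = 0"
  using prime_gt_0_nat[OF assms] by (simp add: ghost_def power_0_left)

lemma ghost_wone:
  assumes "prime p"
  shows "ghost p wone n = 1"
proof -
  have "ghost p wone n = (\<Sum>i\<in>{0}. of_nat p ^ i * wone i ^ (p ^ (n - i)))"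
    unfolding ghost_def using prime_gt_0_nat[OF assms]
    by (intro sum.mono_neutral_right) (auto simp: wone_def power_0_left)
  thus ?thesis by (simp add: wone_def)
qed

lemmas ghost_simps = ghost_wadd ghost_wmult ghost_wneg ghost_0 ghost_wone

lemma wadd_hom:
  assumes "h 1 = 1" "\<And>x y. h (x + y) = h x + h y" "\<And>x y. h (x * y) = h x * h y"
  shows "h \<circ> wadd p x y = wadd p (h \<circ> x) (h \<circ> y)"
proof
  fix n
  have "h \<circ> case_sum x y = case_sum (h \<circ> x) (h \<circ> y)"
    by (auto simp: fun_eq_iff split: sum.splits)
  thus "(h \<circ> wadd p x y) n = wadd p (h \<circ> x) (h \<circ> y) n"
    by (simp add: wadd_def zeval_hom[of h, OF assms])
qed

lemma wmult_hom:
  assumes "h 1 = 1" "\<And>x y. h (x + y) = h x + h y" "\<And>x y. h (x * y) = h x * h y"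
  shows "h \<circ> wmult p x y = wmult p (h \<circ> x) (h \<circ> y)"
proof
  fix n
  have "h \<circ> case_sum x y = case_sum (h \<circ> x) (h \<circ> y)"
    by (auto simp: fun_eq_iff split: sum.splits)
  thus "(h \<circ> wmult p x y) n = wmult p (h \<circ> x) (h \<circ> y) n"
    by (simp add: wmult_def zeval_hom[of h, OF assms])
qed

lemma zeval_wops:
  "wadd p (zeval f \<circ> x) (zeval f \<circ> y) = zeval f \<circ> wadd p x y"
  "wmult p (zeval f \<circ> x) (zeval f \<circ> y) = zeval f \<circ> wmult p x y"
  "wneg p (zeval f \<circ> x) = zeval f \<circ> wneg p x"
  using wadd_hom[of "zeval f" p x y] wmult_hom[of "zeval f" p x y]
  by (simp_all add: wneg_def fun_eq_iff zeval_zeval)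

lemma zeval_wconsts: "wone = zeval f \<circ> wone" "(\<lambda>_. 0) = zeval f \<circ> (\<lambda>_. 0)"
  by (auto simp: wone_def fun_eq_iff)

lemma witt_lift:
  fixes x y z :: "nat \<Rightarrow> 'a::comm_ring_1"
  obtains f :: "nat \<times> nat \<Rightarrow> 'a" and xs ys zs
  where "x = zeval f \<circ> xs" "y = zeval f \<circ> ys" "z = zeval f \<circ> zs"
proof -
  define f where "f = (\<lambda>(j::nat, i). if j = 0 then x i else if j = 1 then y i else z i)"
  show ?thesis
    by (rule that[of f "\<lambda>i. zvar (0, i)" "\<lambda>i. zvar (1, i)" "\<lambda>i. zvar (2, i)"])
       (auto simp: f_def fun_eq_iff)
qed

lemma witt_laws:
  fixes x y z :: "nat \<Rightarrow> 'a::comm_ring_1"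
  assumes "prime p"
  shows "wadd p (wadd p x y) z = wadd p x (wadd p y z)"
    and "wadd p x y = wadd p y x"
    and "wadd p (\<lambda>_. 0) x = x"
    and "wadd p (wneg p x) x = (\<lambda>_. 0)"
    and "wmult p (wmult p x y) z = wmult p x (wmult p y z)"
    and "wmult p x y = wmult p y x"
    and "wmult p wone x = x"
    and "wmult p (wadd p x y) z = wadd p (wmult p x z) (wmult p y z)"
proof -
  obtain f :: "nat \<times> nat \<Rightarrow> 'a" and xs ys zs
    where xyz: "x = zeval f \<circ> xs" "y = zeval f \<circ> ys" "z = zeval f \<circ> zs"
    by (rule witt_lift)
  note * = xyz zeval_wops zeval_wconsts[of f]
  have eq: "zeval f \<circ> s = zeval f \<circ> t" if "\<And>n. ghost p s n = ghost p t n" for s t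
    using ghost_inj[OF assms that] by simp
  show "wadd p (wadd p x y) z = wadd p x (wadd p y z)"
    unfolding * by (rule eq) (simp add: ghost_simps assms add_ac)
  show "wadd p x y = wadd p y x"
    unfolding * by (rule eq) (simp add: ghost_simps assms add_ac)
  show "wadd p (\<lambda>_. 0) x = x"
    unfolding * by (rule eq) (simp add: ghost_simps assms)
  show "wadd p (wneg p x) x = (\<lambda>_. 0)"
    unfolding * by (rule eq) (simp add: ghost_simps assms)
  show "wmult p (wmult p x y) z = wmult p x (wmult p y z)"
    unfolding * by (rule eq) (simp add: ghost_simps assms mult_ac)
  show "wmult p x y = wmult p y x"
    unfolding * by (rule eq) (simp add: ghost_simps assms mult_ac)
  show "wmult p wone x = x"
    unfolding * by (rule eq) (simp add: ghost_simps assms)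
  show "wmult p (wadd p x y) z = wadd p (wmult p x z) (wmult p y z)"
    unfolding * by (rule eq) (simp add: ghost_simps assms algebra_simps)
qed

lemma wadd_0:
  assumes "prime p"
  shows "wadd p x y 0 = x 0 + y 0"
  using ghost_wadd[OF assms, of x y 0] by (simp add: ghost_def)

lemma wmult_0:
  assumes "prime p"
  shows "wmult p x y 0 = x 0 * y 0"
  using ghost_wmult[OF assms, of x y 0] by (simp add: ghost_def)

lemma wadd_iterate_char:
  fixes x :: "nat \<Rightarrow> 'a::comm_ring_1"
  assumes "prime p" "CHAR('a) = p"
  shows "((wadd p x) ^^ p) (\<lambda>_. 0) = (\<lambda>n. case n of 0 \<Rightarrow> 0 | Suc m \<Rightarrow> x m ^ p)"
proof -
  obtain f :: "nat \<times> nat \<Rightarrow> 'a" and xs where x: "x = zeval f \<circ> xs"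
    using witt_lift[of x x x] by metis
  have iter: "((wadd p x) ^^ k) (\<lambda>_. 0) = zeval f \<circ> (((wadd p xs) ^^ k) (\<lambda>_. 0))" for k
  proof (induction k)
    case 0
    show ?case using zeval_wconsts(2)[of f] by simp
  next
    case (Suc k)
    have "((wadd p x) ^^ Suc k) (\<lambda>_. 0) = wadd p x (((wadd p x) ^^ k) (\<lambda>_. 0))" by simp
    also have "\<dots> = zeval f \<circ> wadd p xs (((wadd p xs) ^^ k) (\<lambda>_. 0))"
      unfolding Suc unfolding x zeval_wops ..
    finally show ?case by simp
  qed
  define T where "T = ((wadd p xs) ^^ p) (\<lambda>_. 0)"
  define U where "U n = (case n of 0 \<Rightarrow> 0 | Suc m \<Rightarrow> xs m ^ p)" for n
  have gT: "ghost p T n = of_nat p * ghost p xs n" for n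
  proof -
    have "ghost p (((wadd p xs) ^^ k) (\<lambda>_. 0)) n = of_nat k * ghost p xs n" for k
      by (induction k) (simp_all add: ghost_simps assms algebra_simps)
    thus ?thesis by (simp add: T_def)
  qed
  have gU: "ghost p U n = of_nat p * ghost p xs n - of_nat p ^ Suc n * xs n" for n
  proof (cases n)
    case 0
    thus ?thesis by (simp add: U_def ghost_def)
  next
    case (Suc m)
    have "ghost p U (Suc m) = (\<Sum>i\<le>m. of_nat p ^ Suc i * U (Suc i) ^ (p ^ (m - i)))"
      unfolding ghost_def sum.atMost_Suc_shift
      using prime_gt_0_nat[OF assms(1)] by (simp add: U_def power_0_left)
    also have "\<dots> = of_nat p * (\<Sum>i\<le>m. of_nat p ^ i * xs i ^ (p ^ (Suc m - i)))"
      unfolding sum_distrib_left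
      by (intro sum.cong) (auto simp: U_def Suc_diff_le mult_ac simp flip: power_mult)
    also have "(\<Sum>i\<le>m. of_nat p ^ i * xs i ^ (p ^ (Suc m - i))) = ghost p xs (Suc m) - of_nat p ^ Suc m * xs (Suc m)"
      by (simp add: ghost_split lessThan_Suc_atMost)
    finally show ?thesis by (simp add: Suc algebra_simps)
  qed
  have cong: "of_nat p ^ 1 dvd T n - U n" for n
    by (rule ghost_cong_imp_cong[OF assms(1)]) (simp_all add: gT gU)
  have p0: "(of_nat p :: 'a) = 0" using of_nat_CHAR[where ?'a='a] assms(2) by simp
  have "zeval f (T n) = zeval f (U n)" for n
  proof -
    obtain d where "T n - U n = of_nat p * d" using cong[of n] by (auto elim: dvdE)
    hence "zeval f (T n - U n) = 0" by (simp add: p0)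
    thus ?thesis by simp
  qed
  moreover have "zeval f (U n) = (case n of 0 \<Rightarrow> 0 | Suc m \<Rightarrow> x m ^ p)" for n
    by (cases n) (simp_all add: U_def x)
  ultimately show ?thesis by (simp add: iter fun_eq_iff flip: T_def)
qed

text \<open>$p$-typical Witt vectors over a ring of prime characteristic $p = $ \<open>CHAR('a)\<close>.\<close>

typedef 'a witt = "UNIV :: (nat \<Rightarrow> 'a) set"
  morphisms witt_coeff Witt ..

setup_lifting type_definition_witt

instantiation witt :: (comm_ring_prime_char) comm_ring_1
begin

lift_definition zero_witt :: "'a witt" is "\<lambda>_. 0" .
lift_definition one_witt :: "'a witt" is wone .
lift_definition plus_witt :: "'a witt \<Rightarrow> 'a witt \<Rightarrow> 'a witt" is "wadd CHAR('a)" .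
lift_definition times_witt :: "'a witt \<Rightarrow> 'a witt \<Rightarrow> 'a witt" is "wmult CHAR('a)" .
lift_definition uminus_witt :: "'a witt \<Rightarrow> 'a witt" is "wneg CHAR('a)" .
definition minus_witt :: "'a witt \<Rightarrow> 'a witt \<Rightarrow> 'a witt" where "minus_witt x y = x + (- y)"

instance proof
  fix x y z :: "'a witt"
  have p: "prime CHAR('a)" by simp
  note laws = witt_laws[OF p]
  show "x + y + z = x + (y + z)" by transfer (rule laws)
  show "x + y = y + x" by transfer (rule laws)
  show "0 + x = x" by transfer (rule laws)
  show "- x + x = 0" by transfer (rule laws)
  show "x * y * z = x * (y * z)" by transfer (rule laws)
  show "x * y = y * x" by transfer (rule laws)
  show "1 * x = x" by transfer (rule laws)
  show "(x + y) * z = x * z + y * z" by transfer (rule laws)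
  show "x - y = x + (- y)" by (rule minus_witt_def)
  show "(0 :: 'a witt) \<noteq> 1" by transfer (auto simp: wone_def fun_eq_iff)
qed

end

lemma witt_coeff_CHAR_mult:
  fixes x :: "'a::comm_ring_prime_char witt"
  shows "witt_coeff (of_nat CHAR('a) * x) n = (case n of 0 \<Rightarrow> 0 | Suc m \<Rightarrow> witt_coeff x m ^ CHAR('a))"
proof -
  have "witt_coeff (of_nat k * x) = ((wadd CHAR('a) (witt_coeff x)) ^^ k) (\<lambda>_. 0)" for k
    by (induction k) (simp_all add: zero_witt.rep_eq plus_witt.rep_eq algebra_simps)
  thus ?thesis by (simp add: wadd_iterate_char)
qed

lemma witt_coeff_0_0 [simp]: "witt_coeff 0 n = 0"
  by (simp add: zero_witt.rep_eq)

lemma witt_coeff_mult_0: "witt_coeff (x * y) 0 = witt_coeff x 0 * witt_coeff y 0"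
  by (simp add: times_witt.rep_eq wmult_0)

lemma witt_coeff_CHAR_power_mult:
  fixes x :: "'a::comm_ring_prime_char witt"
  shows "witt_coeff (of_nat CHAR('a) ^ k * x) n =
    (if n < k then 0 else witt_coeff x (n - k) ^ (CHAR('a) ^ k))"
proof (induction k arbitrary: n)
  case (Suc k)
  have "witt_coeff (of_nat CHAR('a) ^ Suc k * x) n = witt_coeff (of_nat CHAR('a) * (of_nat CHAR('a) ^ k * x)) n"
    by (simp add: mult.assoc)
  also have "\<dots> = (if n < Suc k then 0 else witt_coeff x (n - Suc k) ^ (CHAR('a) ^ Suc k))"
    by (subst witt_coeff_CHAR_mult)
       (auto simp: Suc.IH power_0_left power_Suc2 power_mult simp del: power_Suc split: nat.splits)
  finally show ?case .
qed simp

lemma witt_factor: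
  fixes x :: "'a::{alg_closed_field, field_prime_char} witt"
  assumes "x \<noteq> 0"
  obtains k u where "x = of_nat CHAR('a) ^ k * u" "witt_coeff u 0 \<noteq> 0"
proof -
  have "\<exists>n. witt_coeff x n \<noteq> 0"
    using assms by transfer auto
  define k where "k = (LEAST n. witt_coeff x n \<noteq> 0)"
  have k: "witt_coeff x k \<noteq> 0" "\<And>n. n < k \<Longrightarrow> witt_coeff x n = 0"
    using LeastI_ex[OF \<open>\<exists>n. witt_coeff x n \<noteq> 0\<close>] not_less_Least by (auto simp: k_def)
  have "\<exists>y. y ^ (CHAR('a) ^ k) = a" for a :: 'a
    using nth_root_exists[of "CHAR('a) ^ k" a] by auto
  then obtain r :: "'a \<Rightarrow> 'a" where r: "r a ^ (CHAR('a) ^ k) = a" for a by metis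
  define u where "u = Witt (\<lambda>n. r (witt_coeff x (n + k)))"
  have cu: "witt_coeff u n = r (witt_coeff x (n + k))" for n
    by (simp add: u_def Witt_inverse)
  have "witt_coeff x = witt_coeff (of_nat CHAR('a) ^ k * u)"
    by (auto simp: fun_eq_iff witt_coeff_CHAR_power_mult cu r k)
  hence "x = of_nat CHAR('a) ^ k * u" by (simp add: witt_coeff_inject)
  moreover have "witt_coeff u 0 \<noteq> 0"
    using r[of "witt_coeff x k"] k(1) by (auto simp: cu power_0_left)
  ultimately show ?thesis by (rule that)
qed

instance witt :: ("{alg_closed_field, field_prime_char}") idom
proof
  fix x y :: "'a witt"
  assume "x \<noteq> 0" "y \<noteq> 0"
  obtain k u where u: "x = of_nat CHAR('a) ^ k * u" "witt_coeff u 0 \<noteq> 0"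
    using witt_factor[OF \<open>x \<noteq> 0\<close>] .
  obtain l v where v: "y = of_nat CHAR('a) ^ l * v" "witt_coeff v 0 \<noteq> 0"
    using witt_factor[OF \<open>y \<noteq> 0\<close>] .
  have "x * y = of_nat CHAR('a) ^ (k + l) * (u * v)"
    by (simp add: u(1) v(1) power_add mult_ac)
  hence "witt_coeff (x * y) (k + l) = (witt_coeff u 0 * witt_coeff v 0) ^ (CHAR('a) ^ (k + l))"
    by (simp add: witt_coeff_CHAR_power_mult witt_coeff_mult_0)
  also have "\<dots> \<noteq> 0" using u v by simp
  finally show "x * y \<noteq> 0" by auto
qed

text \<open>In characteristic $p$ the Witt vector Frobenius acts by $p$-th powers on components.\<close>

lift_definition witt_frob :: "'a::comm_ring_prime_char witt \<Rightarrow> 'a witt" is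
  "\<lambda>x n. x n ^ CHAR('a)" .

lemma witt_frob_add: "witt_frob (x + y) = witt_frob x + witt_frob y"
proof (transfer)
  fix x y :: "nat \<Rightarrow> 'a"
  show "(\<lambda>n. wadd CHAR('a) x y n ^ CHAR('a)) =
      wadd CHAR('a) (\<lambda>n. x n ^ CHAR('a)) (\<lambda>n. y n ^ CHAR('a))"
    using wadd_hom[of "\<lambda>a::'a. a ^ CHAR('a)" "CHAR('a)" x y]
    by (simp add: freshmans_dream power_mult_distrib o_def)
qed

lemma witt_frob_mult: "witt_frob (x * y) = witt_frob x * witt_frob y"
proof (transfer)
  fix x y :: "nat \<Rightarrow> 'a"
  show "(\<lambda>n. wmult CHAR('a) x y n ^ CHAR('a)) =
      wmult CHAR('a) (\<lambda>n. x n ^ CHAR('a)) (\<lambda>n. y n ^ CHAR('a))"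
    using wmult_hom[of "\<lambda>a::'a. a ^ CHAR('a)" "CHAR('a)" x y]
    by (simp add: freshmans_dream power_mult_distrib o_def)
qed

lemma witt_frob_0 [simp]: "witt_frob 0 = 0"
  by transfer (simp add: power_0_left)

lemma witt_frob_1 [simp]: "witt_frob 1 = 1"
  by transfer (auto simp: wone_def power_0_left)

lemma witt_frob_eq_0_iff [simp]:
  fixes x :: "'a::idom_prime_char witt"
  shows "witt_frob x = 0 \<longleftrightarrow> x = 0"
  by transfer (auto simp: fun_eq_iff)

section \<open>The ring $W(\overline{\mathbb F}_p)$ and its field of fractions\<close>

instance alg_closure :: (field_prime_char) field_prime_char
  by (rule field_prime_charI') simp

text \<open>
  The prime $p$ is the cardinality of the type \<^typ>\<open>'p\<close>, and \<^typ>\<open>'p mod_ring alg_closure\<close>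
  is an algebraic closure of $\mathbb F_p$.  The remaining definitions are stated for
  $W(k)$ with $k$ algebraically closed of characteristic $p = $ \<open>CHAR('k)\<close>.
\<close>

type_synonym 'p W = "'p mod_ring alg_closure witt"

lemma CHAR_mod_ring_alg_closure: "CHAR('p::prime_card mod_ring alg_closure) = CARD('p)"
  by simp

text \<open>The extension of the Witt vector Frobenius to the field of fractions of $W$.\<close>

definition fract_frob ::
  "'k::{alg_closed_field, field_prime_char} witt fract \<Rightarrow> 'k witt fract" where
  "fract_frob q = (THE r. \<forall>x y. y \<noteq> 0 \<and> q = Fract x y \<longrightarrow> r = Fract (witt_frob x) (witt_frob y))"

text \<open>$W[[t]]$ inside the power series over the field of fractions.\<close>

definition integral_fps :: "'k::{alg_closed_field, field_prime_char} witt fract fps set" where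
  "integral_fps = {f. \<forall>n. fps_nth f n \<in> range to_fract}"

section \<open>$p$-adic integers inside the Witt vectors\<close>

text \<open>$\mathbb Z_p = W(\mathbb F_p) \subseteq W$, as the $p$-adic closure of $\mathbb Z$.\<close>

definition padic_ints :: "'k::{alg_closed_field, field_prime_char} witt set" where
  "padic_ints = {x. \<forall>n. \<exists>m. of_nat CHAR('k) ^ n dvd x - of_int m}"

text \<open>Digits are those of $-\alpha$: $\alpha = -\sum_i [\alpha]_i p^i$.\<close>

definition padic_digit :: "'k::{alg_closed_field, field_prime_char} witt \<Rightarrow> nat \<Rightarrow> nat" where
  "padic_digit \<alpha> = (THE d. (\<forall>i. d i < CHAR('k)) \<and>
     (\<forall>n. of_nat CHAR('k) ^ n dvd \<alpha> + (\<Sum>i<n. of_nat (d i) * of_nat CHAR('k) ^ i)))"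

text \<open>The integer $l_\alpha$ and the Dwork prime $\alpha' = (\alpha + l_\alpha) / p$.\<close>

definition dwork_shift :: "'k::{alg_closed_field, field_prime_char} witt \<Rightarrow> nat" where
  "dwork_shift \<alpha> = (THE l. l < CHAR('k) \<and> of_nat CHAR('k) dvd \<alpha> + of_nat l)"

definition dwork_prime :: "'k::{alg_closed_field, field_prime_char} witt \<Rightarrow> 'k witt" where
  "dwork_prime \<alpha> = (THE \<beta>. of_nat CHAR('k) * \<beta> = \<alpha> + of_nat (dwork_shift \<alpha>))"

text \<open>The $p$-adic limit of $f(m)$ as the natural number $m$ tends to $z \in \mathbb Z_p$.\<close>

definition padic_lim ::
  "(nat \<Rightarrow> 'k::{alg_closed_field, field_prime_char} witt) \<Rightarrow> 'k witt \<Rightarrow> 'k witt" where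
  "padic_lim f z = (THE w. \<forall>n. \<exists>N. \<forall>m.
     of_nat CHAR('k) ^ N dvd of_nat m - z \<longrightarrow> of_nat CHAR('k) ^ n dvd f m - w)"

text \<open>$c^z$ for $c \in 1 + pW$ and $z \in \mathbb Z_p$, by continuity.\<close>

definition padic_power ::
  "'k::{alg_closed_field, field_prime_char} witt \<Rightarrow> 'k witt \<Rightarrow> 'k witt" where
  "padic_power c = padic_lim (\<lambda>m. c ^ m)"

text \<open>Morita's $\Gamma_p$; the limit exists for odd $p$.\<close>

definition padic_Gamma :: "'k::{alg_closed_field, field_prime_char} witt \<Rightarrow> 'k witt" where
  "padic_Gamma = padic_lim (\<lambda>m. (- 1) ^ m * of_nat (\<Prod>i | 0 < i \<and> i < m \<and> \<not> CHAR('k) dvd i. i))"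

definition padic_Beta ::
  "'k::{alg_closed_field, field_prime_char} witt \<Rightarrow> 'k witt \<Rightarrow> 'k witt fract" where
  "padic_Beta x y =
     to_fract (padic_Gamma x) * to_fract (padic_Gamma y) / to_fract (padic_Gamma (x + y))"

section \<open>Hypergeometric series and the integral $\widehat G$\<close>

definition hypergeom :: "'a::field \<Rightarrow> 'a \<Rightarrow> 'a \<Rightarrow> 'a fps" where
  "hypergeom \<alpha> \<beta> \<gamma> = Abs_fps (\<lambda>n.
     (pochhammer \<alpha> n * pochhammer \<beta> n) / (pochhammer 1 n * pochhammer \<gamma> n))"

abbreviation hyp ::
  "'k::{alg_closed_field, field_prime_char} witt \<Rightarrow> 'k witt \<Rightarrow> 'k witt \<Rightarrow> 'k witt fract fps" where
  "hyp \<alpha> \<beta> \<gamma> \<equiv> hypergeom (to_fract \<alpha>) (to_fract \<beta>) (to_fract \<gamma>)"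

text \<open>
  Let $\sigma(t) = c t^p$. For a series $f = \sum_m f_m t^m$ we have
  $[t^{\alpha'} f]^\sigma = \sum_m f_m^F c^{\alpha' + m} t^{p(\alpha' + m)}$ and
  $p \alpha' = \alpha + l_\alpha$, so $t^{-\alpha} [t^{\alpha'} f]^\sigma$ is the following power series.
\<close>

definition sigma_twist :: "'k::{alg_closed_field, field_prime_char} witt \<Rightarrow> 'k witt \<Rightarrow>
    'k witt fract fps \<Rightarrow> 'k witt fract fps" where
  "sigma_twist c \<alpha> f = Abs_fps (\<lambda>k.
     if dwork_shift \<alpha> \<le> k \<and> CHAR('k) dvd k - dwork_shift \<alpha> then
       let m = (k - dwork_shift \<alpha>) div CHAR('k)
       in fract_frob (fps_nth f m) * to_fract (padic_power c (dwork_prime \<alpha> + of_nat m))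
     else 0)"

text \<open>$t^{-\alpha} \int_0^t t^\alpha f(t) \frac{dt}{t}$, where $\int_0^t t^\beta \frac{dt}{t} = t^\beta / \beta$.\<close>

definition twisted_integral :: "'a::field \<Rightarrow> 'a fps \<Rightarrow> 'a fps" where
  "twisted_integral \<alpha> f = Abs_fps (\<lambda>k. fps_nth f k / (of_nat k + \<alpha>))"

text \<open>
  \<open>G_hat c a\<close> and \<open>F_hat c a\<close> are $\widehat G^{(\sigma)}_{a,a;2a}$ and
  $\widehat{\mathscr F}^{(\sigma)}_{a,a;2a}$ for $\sigma(t) = c t^p$.
\<close>

definition G_hat :: "'k::{alg_closed_field, field_prime_char} witt \<Rightarrow> 'k witt \<Rightarrow> 'k witt fract fps" where
  "G_hat c a = twisted_integral (to_fract a)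
     (hyp a a (2 * a) - fps_const ((- 1) ^ dwork_shift a * inverse (padic_Beta a a)) *
        sigma_twist c a (hyp (dwork_prime a) (dwork_prime a) (dwork_prime (2 * a))))"

definition F_hat :: "'k::{alg_closed_field, field_prime_char} witt \<Rightarrow> 'k witt \<Rightarrow> 'k witt fract fps" where
  "F_hat c a = G_hat c a / hyp a a (2 * a)"

section \<open>The explicit form of the coefficients of $\widehat G$\<close>

lemma CHAR_power_separated:
  fixes x :: "'k::{alg_closed_field, field_prime_char} witt"
  assumes "\<And>n. of_nat CHAR('k) ^ n dvd x"
  shows "x = 0"
proof -
  have "witt_coeff x i = 0" for i
  proof -
    obtain u where "x = of_nat CHAR('k) ^ Suc i * u"
      using assms[of "Suc i"] by (elim dvdE)
    thus ?thesis by (simp only: witt_coeff_CHAR_power_mult) simp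
  qed
  hence "witt_coeff x = witt_coeff 0" by (simp add: fun_eq_iff)
  thus ?thesis by (simp add: witt_coeff_inject)
qed

lemma witt_coeff_of_int_0: "witt_coeff (of_int m :: 'k::comm_ring_prime_char witt) 0 = of_int m"
proof -
  have one: "witt_coeff (1 :: 'k witt) 0 = 1" by (simp add: one_witt.rep_eq wone_def)
  have add: "witt_coeff (x + y) 0 = witt_coeff x 0 + witt_coeff y 0" for x y :: "'k witt"
    by (simp add: plus_witt.rep_eq wadd_0)
  have neg: "witt_coeff (- x) 0 = - witt_coeff x 0" for x :: "'k witt"
    using add[of x "- x"] by (simp add: eq_neg_iff_add_eq_0 add.commute)
  have nat: "witt_coeff (of_nat n :: 'k witt) 0 = of_nat n" for n
    by (induction n) (simp_all add: one add)
  show ?thesis by (cases m rule: int_cases2) (simp_all add: nat neg)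
qed

lemma CHAR_dvd_of_int_witt_iff:
  "(of_nat CHAR('k) :: 'k::{alg_closed_field, field_prime_char} witt) dvd of_int m \<longleftrightarrow> int CHAR('k) dvd m"
proof
  assume "(of_nat CHAR('k) :: 'k witt) dvd of_int m"
  then obtain u :: "'k witt" where "of_int m = of_nat CHAR('k) * u" by (elim dvdE)
  hence "witt_coeff (of_int m :: 'k witt) 0 = 0" by (simp only: witt_coeff_CHAR_mult) simp
  thus "int CHAR('k) dvd m" by (simp add: witt_coeff_of_int_0 of_int_eq_0_iff_char_dvd)
next
  assume "int CHAR('k) dvd m"
  thus "(of_nat CHAR('k) :: 'k witt) dvd of_int m" by (elim dvdE) simp
qed

lemma of_nat_CHAR_witt_nonzero: "(of_nat CHAR('k) :: 'k::{alg_closed_field, field_prime_char} witt) \<noteq> 0"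
proof
  assume "(of_nat CHAR('k) :: 'k witt) = 0"
  hence "witt_coeff (of_nat CHAR('k) * (1 :: 'k witt)) 1 = 0" by simp
  thus False by (simp only: witt_coeff_CHAR_mult) (simp add: one_witt.rep_eq wone_def)
qed

lemma dwork_shift_props:
  fixes a :: "'k::{alg_closed_field, field_prime_char} witt"
  assumes "a \<in> padic_ints"
  shows "dwork_shift a < CHAR('k)" "of_nat CHAR('k) dvd a + of_nat (dwork_shift a)"
proof -
  have "\<exists>m. of_nat CHAR('k) ^ 1 dvd a - of_int m"
    using assms unfolding padic_ints_def by blast
  then obtain m where m: "of_nat CHAR('k) dvd a - of_int m" by auto
  define l where "l = nat ((- m) mod int CHAR('k))"
  have l: "l < CHAR('k)" "int CHAR('k) dvd m + int l"
    by (simp_all add: l_def nat_less_iff mod_eq_0_iff_dvd[symmetric] mod_simps)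
  have "(of_nat CHAR('k) :: 'k witt) dvd of_int (m + int l)"
    using l(2) CHAR_dvd_of_int_witt_iff by blast
  from dvd_add[OF m this] have al: "of_nat CHAR('k) dvd a + of_nat l" by simp
  have "\<exists>!l. l < CHAR('k) \<and> of_nat CHAR('k) dvd a + of_nat l"
  proof (rule ex1I[of _ l])
    fix l' assume l': "l' < CHAR('k) \<and> of_nat CHAR('k) dvd a + of_nat l'"
    have "(of_nat CHAR('k) :: 'k witt) dvd (a + of_nat l') - (a + of_nat l)"
      using l' al by (intro dvd_diff) auto
    also have "(a + of_nat l') - (a + of_nat l) = of_int (int l' - int l)" by simp
    finally have "int CHAR('k) dvd int l' - int l" by (simp only: CHAR_dvd_of_int_witt_iff)
    hence "int l' mod int CHAR('k) = int l mod int CHAR('k)" by (simp add: mod_eq_dvd_iff)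
    with l l' show "l' = l" by simp
  qed (use l al in auto)
  from theI'[OF this] show "dwork_shift a < CHAR('k)" "of_nat CHAR('k) dvd a + of_nat (dwork_shift a)"
    by (simp_all add: dwork_shift_def)
qed

lemma dwork_prime_eq:
  fixes a :: "'k::{alg_closed_field, field_prime_char} witt"
  assumes "a \<in> padic_ints"
  shows "of_nat CHAR('k) * dwork_prime a = a + of_nat (dwork_shift a)"
proof -
  have "\<exists>!\<beta>. of_nat CHAR('k) * \<beta> = a + of_nat (dwork_shift a)"
  proof (rule ex_ex1I)
    show "\<exists>\<beta>. of_nat CHAR('k) * \<beta> = a + of_nat (dwork_shift a)"
      using dwork_shift_props(2)[OF assms] by (metis dvdE)
  next
    fix b b' assume "of_nat CHAR('k) * b = a + of_nat (dwork_shift a)"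
      "of_nat CHAR('k) * b' = a + of_nat (dwork_shift a)"
    hence "of_nat CHAR('k) * b = of_nat CHAR('k) * b'" by simp
    thus "b = b'" using of_nat_CHAR_witt_nonzero[where ?'k = 'k] mult_left_cancel by blast
  qed
  from theI'[OF this] show ?thesis by (simp add: dwork_prime_def)
qed

lemma dwork_prime_padic_int:
  fixes a :: "'k::{alg_closed_field, field_prime_char} witt"
  assumes "a \<in> padic_ints"
  shows "dwork_prime a \<in> padic_ints"
  unfolding padic_ints_def
proof safe
  fix n
  let ?p = "of_nat CHAR('k) :: 'k witt"
  obtain m where m: "?p ^ Suc n dvd a - of_int m"
    using assms unfolding padic_ints_def by blast
  have "?p dvd (a + of_nat (dwork_shift a)) - (a - of_int m)"
    by (intro dvd_diff dwork_shift_props assms dvd_trans[OF _ m]) simp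
  also have "\<dots> = of_int (m + int (dwork_shift a))" by simp
  finally obtain j where j: "m + int (dwork_shift a) = int CHAR('k) * j"
    by (auto simp only: CHAR_dvd_of_int_witt_iff elim: dvdE)
  have "?p * (dwork_prime a - of_int j) = a + of_nat (dwork_shift a) - of_int (int CHAR('k) * j)"
    by (simp add: right_diff_distrib dwork_prime_eq[OF assms])
  also have "\<dots> = a - of_int m" by (simp add: j[symmetric])
  finally have "?p * ?p ^ n dvd ?p * (dwork_prime a - of_int j)" using m by simp
  hence "?p ^ n dvd dwork_prime a - of_int j"
    using of_nat_CHAR_witt_nonzero[where ?'k = 'k] by (simp only: dvd_mult_cancel_left) simp
  thus "\<exists>m. ?p ^ n dvd dwork_prime a - of_int m" by blast
qed

lemma padic_ints_closed:
  fixes x y :: "'k::{alg_closed_field, field_prime_char} witt"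
  assumes "x \<in> padic_ints" "y \<in> padic_ints"
  shows "x + y \<in> padic_ints"
  unfolding padic_ints_def
proof safe
  fix n
  obtain i j where "of_nat CHAR('k) ^ n dvd x - of_int i" "of_nat CHAR('k) ^ n dvd y - of_int j"
    using assms unfolding padic_ints_def by blast
  from dvd_add[OF this] have "of_nat CHAR('k) ^ n dvd (x + y) - of_int (i + j)"
    by (simp add: algebra_simps)
  thus "\<exists>m. of_nat CHAR('k) ^ n dvd x + y - of_int m" by blast
qed

lemma witt_frob_of_nat [simp]: "witt_frob (of_nat n) = of_nat n"
  by (induction n) (simp_all add: witt_frob_add)

lemma witt_frob_uminus: "witt_frob (- x) = - witt_frob x"
  using witt_frob_add[of x "- x"] by (simp add: eq_neg_iff_add_eq_0 add.commute)

lemma witt_frob_of_int [simp]: "witt_frob (of_int n) = of_int n"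
  by (cases n rule: int_cases2) (simp_all add: witt_frob_uminus)

lemma witt_frob_power: "witt_frob (x ^ n) = witt_frob x ^ n"
  by (induction n) (simp_all add: witt_frob_mult)

lemma witt_frob_padic_int:
  fixes x :: "'k::{alg_closed_field, field_prime_char} witt"
  assumes "x \<in> padic_ints"
  shows "witt_frob x = x"
proof -
  have "of_nat CHAR('k) ^ n dvd witt_frob x - x" for n
  proof -
    obtain m where m: "of_nat CHAR('k) ^ n dvd x - of_int m"
      using assms unfolding padic_ints_def by blast
    then obtain u where u: "x - of_int m = of_nat CHAR('k) ^ n * u" by (elim dvdE)
    have "witt_frob x = witt_frob (of_int m + (x - of_int m))" by simp
    also have "\<dots> = of_int m + of_nat CHAR('k) ^ n * witt_frob u"
      unfolding u witt_frob_add by (simp add: witt_frob_mult witt_frob_power)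
    finally have "witt_frob x - x = of_nat CHAR('k) ^ n * witt_frob u - (x - of_int m)"
      by simp
    show ?thesis unfolding \<open>witt_frob x - x = _\<close> by (rule dvd_diff[OF dvd_triv_left m])
  qed
  thus ?thesis using CHAR_power_separated[of "witt_frob x - x"] by simp
qed

lemma fract_frob_Fract:
  assumes "y \<noteq> 0"
  shows "fract_frob (Fract x y) = Fract (witt_frob x) (witt_frob y)"
  unfolding fract_frob_def
proof (rule the_equality)
  show "\<forall>x' y'. y' \<noteq> 0 \<and> Fract x y = Fract x' y' \<longrightarrow>
      Fract (witt_frob x) (witt_frob y) = Fract (witt_frob x') (witt_frob y')"
    using assms by (auto simp: eq_fract simp flip: witt_frob_mult)
qed (use assms in blast)

lemma fract_frob_hom:
  fixes x y :: "'k::{alg_closed_field, field_prime_char} witt fract"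
  shows "fract_frob (x + y) = fract_frob x + fract_frob y"
  and "fract_frob (x * y) = fract_frob x * fract_frob y"
  and "fract_frob (x / y) = fract_frob x / fract_frob y"
  and "fract_frob (to_fract z) = (to_fract (witt_frob z) :: 'k witt fract)"
proof -
  show "fract_frob (x + y) = fract_frob x + fract_frob y"
    by (cases x; cases y) (simp add: fract_frob_Fract witt_frob_mult witt_frob_add)
  show "fract_frob (x * y) = fract_frob x * fract_frob y"
    by (cases x; cases y) (simp add: fract_frob_Fract witt_frob_mult)
  show z: "fract_frob (to_fract z) = (to_fract (witt_frob z) :: 'k witt fract)" for z
    by (simp add: to_fract_def fract_frob_Fract)
  show "fract_frob (x / y) = fract_frob x / fract_frob y"
  proof (cases x; cases y)
    fix a b c d assume *: "x = Fract a b" "b \<noteq> 0" "y = Fract c d" "d \<noteq> 0"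
    show ?thesis
    proof (cases "c = 0")
      case True
      hence "y = 0" by (simp add: * fract_collapse)
      thus ?thesis using z[of 0] by simp
    next
      case False
      with * show ?thesis by (simp add: fract_frob_Fract witt_frob_mult)
    qed
  qed
qed

lemma fract_frob_pochhammer:
  fixes x :: "'k::{alg_closed_field, field_prime_char} witt fract"
  assumes "fract_frob x = x"
  shows "fract_frob (pochhammer x n) = pochhammer x n"
proof -
  have 1: "fract_frob 1 = (1 :: 'k witt fract)" using fract_frob_hom(4)[of 1] by simp
  have "fract_frob (of_nat n) = (of_nat n :: 'k witt fract)" for n
    by (induction n) (use fract_frob_hom(4)[of 0] in \<open>simp_all add: 1 fract_frob_hom\<close>)
  thus ?thesis
    by (induction n) (simp_all add: 1 pochhammer_Suc fract_frob_hom assms)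
qed

lemma fract_frob_hypergeom:
  fixes \<alpha> :: "'k::{alg_closed_field, field_prime_char} witt fract"
  assumes "fract_frob \<alpha> = \<alpha>" "fract_frob \<beta> = \<beta>" "fract_frob \<gamma> = \<gamma>"
  shows "fract_frob (fps_nth (hypergeom \<alpha> \<beta> \<gamma>) n) = fps_nth (hypergeom \<alpha> \<beta> \<gamma>) n"
  using fract_frob_hom(4)[of "1 :: 'k witt"] assms
  by (simp add: hypergeom_def fract_frob_hom fract_frob_pochhammer)

lemma G_hat_coeff:
  fixes a c :: "'k::{alg_closed_field, field_prime_char} witt"
  assumes "a \<in> padic_ints"
  defines "A \<equiv> fps_nth (hyp a a (2 * a))"
    and "A1 \<equiv> fps_nth (hyp (dwork_prime a) (dwork_prime a) (dwork_prime (2 * a)))"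
    and "l \<equiv> dwork_shift a"
  shows "fps_nth (G_hat c a) k = 1 / (of_nat k + to_fract a) *
    (A k - (- 1) ^ l * inverse (padic_Beta a a) *
       (if l \<le> k \<and> CHAR('k) dvd k - l then
          A1 ((k - l) div CHAR('k)) *
          to_fract (padic_power c (THE e. of_nat CHAR('k) * e = of_nat k + a))
        else 0))"
proof -
  have "2 * a \<in> padic_ints" using padic_ints_closed[OF assms(1) assms(1)] by (simp flip: mult_2)
  hence "witt_frob (dwork_prime (2 * a)) = dwork_prime (2 * a)"
    "witt_frob (dwork_prime a) = dwork_prime a"
    by (intro witt_frob_padic_int dwork_prime_padic_int assms(1); assumption)+
  hence frob: "fract_frob (A1 m) = A1 m" for m
    unfolding A1_def by (intro fract_frob_hypergeom) (simp_all add: fract_frob_hom(4))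
  have exponent: "(THE e. of_nat CHAR('k) * e = of_nat k + a) = dwork_prime a + of_nat ((k - l) div CHAR('k))"
    if "l \<le> k" "CHAR('k) dvd k - l"
  proof (rule the_equality)
    have "of_nat CHAR('k) * of_nat ((k - l) div CHAR('k)) = (of_nat (k - l) :: 'k witt)"
      using that(2) by (simp flip: of_nat_mult)
    thus eq: "of_nat CHAR('k) * (dwork_prime a + of_nat ((k - l) div CHAR('k))) = of_nat k + a"
      using that(1) by (simp add: distrib_left dwork_prime_eq[OF assms(1)] l_def of_nat_diff)
    show "e = dwork_prime a + of_nat ((k - l) div CHAR('k))" if "of_nat CHAR('k) * e = of_nat k + a" for e
      using that eq of_nat_CHAR_witt_nonzero[where ?'k = 'k] mult_left_cancel by metis
  qed
  show ?thesis
    using frob exponent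
    by (auto simp: G_hat_def twisted_integral_def sigma_twist_def Let_def l_def A_def A1_def)
qed

end

theory Submission
  imports Defs
begin

text \<open>
  Write $A_k = (a)_k^2 / (k! (2a)_k)$ for the coefficients of $F_{a,a;2a}$ and $A^{(1)}_m$ for
  those of $F_{a',a';(2a)'}$, and let $l = l_a$.  Since $B_k$ is a difference divided by $k + a$,
  the claim is that this difference is divisible by $k + a$.

  Both the integrality of the $A_k$ and the congruences between them come from Dwork's
  factorisation of a Pochhammer symbol (\<open>pochhammer_dwork\<close>): among the factors
  $\alpha, \alpha + 1, \dots$ of $(\alpha)_k$ the multiples of $p$ are
  $\alpha + l_\alpha + pj = p (\alpha' + j)$, so that $(\alpha)_k$ is a product of units times
  $p^n (\alpha')_n$, where $n$ counts these multiples.  The condition $[a]_i < [2a]_i$ means that no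
  carry occurs when $a$ is doubled, whence $0 < l$, $l_{2a} = 2l$ and $(2a)' = 2a'$, and the
  condition passes to $a'$ (\<open>digit_dominated_props\<close>).  So the factorisations of $(a)_k$,
  $(2a)_k$ and $(1)_k$ relate the hypergeometric coefficients for $a$ to those for $a'$.  An
  induction along $k \mapsto \lfloor k/p \rfloor$ gives $A_k \in W$
  (\<open>pochhammer_sq_dvd\<close>).

  If $k \not\equiv l$ modulo $p$, then $k + a$ is a unit and the second term of the difference is
  $0$.  If $k = l + pm$, the powers of $p$ cancel and $A_k / A^{(1)}_m$ is a quotient of products of
  units.  Modulo $p^n$ with $p^n \mid k + a$, these products depend only on a natural number $N$
  with $N \equiv a$, and they are quotients of values of $\Gamma_p$ at natural numbers.  As
  $N + k \equiv 0$, the periodicity $\Gamma_p(x + p^n) \equiv \Gamma_p(x)$, which is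
  Wilson's theorem modulo $p^n$, and the reflection formula turn the quotient into
  $(-1)^l \Gamma_p(2a) / \Gamma_p(a)^2 = (-1)^l B_p(a,a)^{-1}$
  (\<open>strip_pochhammer_Gamma_cong\<close>, \<open>witt_hyp_coeff_cong\<close>).  Finally
  $(k + a)/p$ is divisible by $p^{n-1}$ and $c \in 1 + pW$, so $c^{(k+a)/p} \equiv 1$ modulo
  $p^n$ (\<open>padic_power_cong_1\<close>).

  The limits that define $\Gamma_p$ and $c^z$ exist because $W$ is $p$-adically complete; this is
  derived from the fact that congruence modulo $p^n$ means equality of the first $n$ Witt
  components (\<open>witt_cong_iff_coeff\<close>).
\<close>

section \<open>Congruences in a commutative ring\<close>

lemma dvd_diff_trans:
  fixes x y z :: "'a::comm_ring_1"
  assumes "q dvd x - y" "q dvd y - z"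
  shows "q dvd x - z"
  using dvd_add[OF assms] by simp

lemma dvd_diff_sym:
  fixes x y :: "'a::comm_ring_1"
  shows "q dvd x - y \<Longrightarrow> q dvd y - x"
  by (metis dvd_minus_iff minus_diff_eq)

lemma dvd_mult_diff:
  fixes x y u v :: "'a::comm_ring_1"
  assumes "q dvd x - y" "q dvd u - v"
  shows "q dvd x * u - y * v"
proof -
  have "q dvd (x - y) * u + y * (u - v)" using assms by simp
  thus ?thesis by (simp add: algebra_simps)
qed

section \<open>The prime-to-$p$ part of a Pochhammer symbol\<close>

text \<open>
  A multiple of $p$ is replaced by $1$, so that a product over a full range of arguments becomes the
  product of those factors that are prime to $p$.
\<close>

definition strip :: "nat \<Rightarrow> 'a::comm_ring_1 \<Rightarrow> 'a" where
  "strip p x = (if of_nat p dvd x then 1 else x)"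

definition strip_pochhammer :: "nat \<Rightarrow> 'a::comm_ring_1 \<Rightarrow> nat \<Rightarrow> 'a" where
  "strip_pochhammer p x k = (\<Prod>i<k. strip p (x + of_nat i))"

text \<open>
  The value of $\Gamma_p$ at a natural number.  The factor at $0$ is a multiple of $p$, hence
  stripped, so the product over $i < m$ is that over $0 < i < m$.
\<close>

definition morita :: "nat \<Rightarrow> nat \<Rightarrow> int" where
  "morita p m = (- 1) ^ m * strip_pochhammer p 0 m"

lemma strip_pochhammer_0 [simp]: "strip_pochhammer p x 0 = 1"
  by (simp add: strip_pochhammer_def)

lemma strip_pochhammer_Suc:
  "strip_pochhammer p x (Suc k) = strip_pochhammer p x k * strip p (x + of_nat k)"
  by (simp add: strip_pochhammer_def)

lemma strip_pochhammer_add: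
  "strip_pochhammer p x (j + k) = strip_pochhammer p x j * strip_pochhammer p (x + of_nat j) k"
  by (induction k) (simp_all add: strip_pochhammer_Suc mult.assoc add.assoc)

lemma strip_cong:
  fixes x y :: "'a::comm_ring_1"
  assumes "of_nat p ^ n dvd x - y" "n \<ge> 1"
  shows "of_nat p ^ n dvd strip p x - strip p y"
proof -
  have "of_nat p dvd (of_nat p :: 'a) ^ n" using assms(2) by (simp add: dvd_power)
  hence d: "of_nat p dvd x - y" using assms(1) by (rule dvd_trans)
  have "of_nat p dvd x \<longleftrightarrow> of_nat p dvd y"
    using dvd_diff[OF _ d, of x] dvd_add[OF _ d, of y] by auto
  thus ?thesis using assms(1) by (auto simp: strip_def)
qed

text \<open>
  Congruent arguments have their multiples of $p$ in the same places, so the products are congruent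
  factor by factor.
\<close>

lemma strip_pochhammer_cong:
  fixes x y :: "'a::comm_ring_1"
  assumes "of_nat p ^ n dvd x - y" "n \<ge> 1"
  shows "of_nat p ^ n dvd strip_pochhammer p x k - strip_pochhammer p y k"
  by (induction k) (auto simp: strip_pochhammer_Suc intro!: dvd_mult_diff strip_cong assms)

lemma strip_of_int:
  assumes "\<And>m. of_nat p dvd (of_int m :: 'a::comm_ring_1) \<longleftrightarrow> int p dvd m"
  shows "strip p (of_int m :: 'a) = of_int (strip p m)"
  by (simp add: strip_def assms)

lemma coprime_strip_pochhammer:
  fixes x :: int
  assumes "prime p"
  shows "coprime (strip_pochhammer p x k) (int p ^ n)"
  unfolding strip_pochhammer_def
proof (intro prod_coprime_left)
  fix i
  have "prime (int p)" using assms by simp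
  hence "coprime (int p) (strip p (x + int i))"
    unfolding strip_def by (auto intro: prime_imp_coprime)
  thus "coprime (strip p (x + of_nat i)) (int p ^ n)"
    by (simp add: coprime_commute)
qed

lemma morita_0 [simp]: "morita p 0 = 1"
  by (simp add: morita_def)

lemma morita_add: "morita p (x + k) = morita p x * (- 1) ^ k * strip_pochhammer p (int x) k"
  by (simp add: morita_def strip_pochhammer_add power_add)

lemma morita_Suc: "morita p (Suc k) = (- 1) ^ Suc k * strip_pochhammer p 1 k"
  using morita_add[of p 1 k]
  by (simp add: morita_def strip_pochhammer_Suc strip_def)

section \<open>$\Gamma_p$ at natural numbers modulo $p^n$\<close>

lemma prod_arith_progression_cong:
  "\<exists>d. (\<Prod>j<r. x + int j * q) = x ^ r + x ^ (r - 1) * q * (\<Sum>j<r. int j) + q ^ 2 * d"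
proof (induction r)
  case 0
  show ?case by (intro exI[of _ 0]) simp
next
  case (Suc r)
  then obtain d where d: "(\<Prod>j<r. x + int j * q) = x ^ r + x ^ (r - 1) * q * (\<Sum>j<r. int j) + q ^ 2 * d"
    by blast
  define y S where "y = x ^ (r - 1)" and "S = (\<Sum>j<r. int j)"
  have e: "x * y * S = x ^ r * S"
    by (cases r) (simp_all add: y_def S_def)
  have "(\<Prod>j<Suc r. x + int j * q) = (x ^ r + y * q * S + q ^ 2 * d) * (x + int r * q)"
    by (simp add: d y_def S_def)
  also have "\<dots> = x ^ Suc r + x ^ r * q * (S + int r) + q ^ 2 * (d * (x + int r * q) + int r * y * S)
      + q * (x * y * S - x ^ r * S)"
    by (simp add: algebra_simps power2_eq_square)
  finally have "(\<Prod>j<Suc r. x + int j * q) = x ^ Suc r + x ^ (Suc r - 1) * q * (\<Sum>j<Suc r. int j)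
     + q ^ 2 * (d * (x + int r * q) + int r * y * S)"
    by (simp only: e) (simp add: S_def)
  thus ?case by blast
qed

text \<open>
  In the expansion of the product in powers of $p^n$ the linear term carries the sum
  $0 + \dots + (p-1)$, which is a multiple of $p$ because $p$ is odd.
\<close>

lemma prod_arith_progression_prime_cong:
  assumes "prime p" "odd p" "n \<ge> 1"
  shows "[(\<Prod>j<p. x + int j * int p ^ n) = x ^ p] (mod int p ^ Suc n)"
proof -
  obtain d where d: "(\<Prod>j<p. x + int j * int p ^ n) =
      x ^ p + x ^ (p - 1) * int p ^ n * (\<Sum>j<p. int j) + (int p ^ n) ^ 2 * d"
    using prod_arith_progression_cong by blast
  obtain h where h: "p = Suc (2 * h)" using assms(2) by (auto elim: oddE)
  have "(\<Sum>j<Suc (2*h). int j) = int (Suc (2*h)) * int h"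
    by (induction h) (simp_all add: algebra_simps)
  hence s: "(\<Sum>j<p. int j) = int p * int h" by (simp only: h)
  have "(int p ^ n) ^ 2 = int p ^ Suc n * int p ^ (n - 1)"
  proof -
    have "2 * n = Suc n + (n - 1)" using assms(3) by simp
    thus ?thesis by (simp only: power_mult[symmetric] power_add[symmetric] mult.commute[of n 2])
  qed
  hence "(\<Prod>j<p. x + int j * int p ^ n) - x ^ p =
      int p ^ Suc n * (x ^ (p - 1) * int h + int p ^ (n - 1) * d)"
    by (simp add: d s algebra_simps)
  thus ?thesis by (simp add: cong_iff_dvd_diff)
qed

text \<open>
  Wilson's theorem is lifted from $p^n$ to $p^{n+1}$: the numbers below $p^{n+1}$ fall into the
  progressions $i + j p^n$ with $j < p$, and by the preceding congruence each progression multiplies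
  to $i^p$.  The product for $p^{n+1}$ is thus the $p$-th power of the one for $p^n$, and raising to
  the $p$-th power improves a congruence modulo $p^n$ to one modulo $p^{n+1}$.
\<close>

lemma wilson_prime_power:
  assumes "prime p" "odd p" "1 \<le> n"
  shows "[strip_pochhammer p 0 (p ^ n) = (-1 :: int)] (mod int p ^ n)"
  using assms(3)
proof (induction n rule: dec_induct)
  case base
  show ?case
  proof -
    have "{..<p} = insert 0 {1..p-1}" using prime_gt_0_nat[OF assms(1)] by auto
    hence "strip_pochhammer p 0 p = (\<Prod>i=1..p-1. strip p (int i))"
      by (simp add: strip_pochhammer_def strip_def)
    also have "\<dots> = (\<Prod>i=1..p-1. int i)"
      by (intro prod.cong) (auto simp: strip_def dest: dvd_imp_le)
    also have "\<dots> = fact (p - 1)" by (simp add: fact_prod)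
    finally show ?thesis using wilson_theorem[OF assms(1)] by simp
  qed
next
  case (step n)
  let ?q = "p ^ n"
  have pq: "int p dvd int ?q" using step(1) by (simp add: dvd_power)
  have "strip_pochhammer p 0 (p ^ Suc n) = (\<Prod>j<p. \<Prod>i\<in>{j*?q..<j*?q+?q}. strip p (int i))"
    unfolding prod.nat_group by (simp add: strip_pochhammer_def)
  also have "\<dots> = (\<Prod>j<p. \<Prod>i<?q. strip p (int i + int j * int ?q))"
  proof (rule prod.cong[OF refl])
    fix j
    show "(\<Prod>i\<in>{j*?q..<j*?q+?q}. strip p (int i)) = (\<Prod>i<?q. strip p (int i + int j * int ?q))"
      by (rule prod.reindex_bij_witness[of _ "\<lambda>i. i + j * ?q" "\<lambda>i. i - j * ?q"]) auto
  qed
  also have "\<dots> = (\<Prod>i<?q. \<Prod>j<p. strip p (int i + int j * int ?q))"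
    by (rule prod.swap)
  also have "[\<dots> = (\<Prod>i<?q. strip p (int i) ^ p)] (mod int p ^ Suc n)"
  proof (intro cong_prod)
    fix i
    have "int p dvd int i + int j * int ?q \<longleftrightarrow> int p dvd int i" for j
      using pq by (meson dvd_add_left_iff dvd_mult)
    thus "[(\<Prod>j<p. strip p (int i + int j * int ?q)) = strip p (int i) ^ p] (mod int p ^ Suc n)"
      using prod_arith_progression_prime_cong[OF assms(1,2) step(1), of "int i"]
      by (auto simp: strip_def)
  qed
  also have "(\<Prod>i<?q. strip p (int i) ^ p) = strip_pochhammer p 0 ?q ^ p"
    by (simp add: strip_pochhammer_def prod_power_distrib)
  also have "[\<dots> = (-1) ^ p] (mod int p ^ Suc n)"
    using dvd_power_lift[of n p "strip_pochhammer p 0 ?q" "-1 :: int" 1] step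
    by (simp add: cong_iff_dvd_diff)
  finally show ?case using assms(2) by simp
qed

text \<open>
  The product over the residues $0, \dots, x + p^n - 1$ can be split at $x$ or at $p^n$; comparing
  the two reduces an arbitrary period to the one that starts at $0$.
\<close>

lemma strip_pochhammer_full_period:
  fixes x :: nat
  assumes "prime p" "odd p" "n \<ge> 1"
  shows "[strip_pochhammer p (int x) (p ^ n) = -1] (mod int p ^ n)"
proof -
  have "strip_pochhammer p 0 x * strip_pochhammer p (int x) (p ^ n) =
        strip_pochhammer p 0 (p ^ n) * strip_pochhammer p (int (p ^ n)) x"
    using strip_pochhammer_add[of p "0::int" x "p ^ n"] strip_pochhammer_add[of p "0::int" "p ^ n" x]
    by (simp add: add.commute)
  also have "[\<dots> = -1 * strip_pochhammer p 0 x] (mod int p ^ n)"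
    using strip_pochhammer_cong[of p n "int (p ^ n)" 0 x] assms(3)
    by (intro cong_mult wilson_prime_power assms) (simp_all add: cong_iff_dvd_diff)
  finally show ?thesis
    using coprime_strip_pochhammer[OF assms(1), of 0 x n]
    by (metis cong_mult_lcancel mult.commute)
qed

text \<open>
  Adding $p^n$ to the argument contributes the sign $(-1)^{p^n} = -1$ and a full period, whose
  product is $-1$ by Wilson's theorem.
\<close>

lemma morita_cong:
  assumes "prime p" "odd p" "n \<ge> 1" "[x = y] (mod p ^ n)"
  shows "[morita p x = morita p y] (mod int p ^ n)"
proof -
  have step: "[morita p (x + p ^ n) = morita p x] (mod int p ^ n)" for x
  proof -
    have "morita p (x + p ^ n) = (- morita p x) * strip_pochhammer p (int x) (p ^ n)"
      using assms(2) by (simp add: morita_add)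
    also have "[\<dots> = (- morita p x) * (- 1)] (mod int p ^ n)"
      by (rule cong_mult[OF cong_refl strip_pochhammer_full_period[OF assms(1-3)]])
    finally show ?thesis by simp
  qed
  have mult: "[morita p (x + k * p ^ n) = morita p x] (mod int p ^ n)" for x k
  proof (induction k)
    case (Suc k)
    have "[morita p ((x + k * p ^ n) + p ^ n) = morita p x] (mod int p ^ n)"
      using step Suc cong_trans by blast
    thus ?case by (simp add: algebra_simps)
  qed simp
  have "[morita p x = morita p (x mod p ^ n)] (mod int p ^ n)" for x
    using mult[of "x mod p ^ n" "x div p ^ n"] unfolding mod_div_mult_eq .
  hence "morita p x mod int p ^ n = morita p (x mod p ^ n) mod int p ^ n" for x
    unfolding unique_euclidean_semiring_class.cong_def .
  moreover have "x mod p ^ n = y mod p ^ n"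
    using assms(4) unfolding unique_euclidean_semiring_class.cong_def .
  ultimately show ?thesis unfolding unique_euclidean_semiring_class.cong_def by metis
qed

text \<open>
  Of the $k$ signs, the $\lfloor k/p \rfloor$ ones at multiples of $p$ are lost.
\<close>

lemma prod_strip_uminus:
  assumes "p > 0"
  shows "(\<Prod>i<k. strip p (- 1 - int i)) = (-1) ^ (k + k div p) * strip_pochhammer p 1 k"
proof (induction k)
  case (Suc k)
  have "int p dvd - 1 - int k \<longleftrightarrow> p dvd Suc k"
    by (metis dvd_minus_iff minus_add_distrib of_nat_Suc of_nat_dvd_iff uminus_add_conv_diff add.commute)
  moreover have "int p dvd 1 + int k \<longleftrightarrow> p dvd Suc k"
    by (metis of_nat_Suc of_nat_dvd_iff)
  ultimately have "strip p (- 1 - int k) = (if p dvd Suc k then 1 else -1) * strip p (1 + int k)"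
    by (simp add: strip_def)
  moreover have "Suc k div p = (if p dvd Suc k then Suc (k div p) else k div p)"
    by (simp add: div_Suc dvd_eq_mod_eq_0)
  ultimately show ?case by (simp add: Suc strip_pochhammer_Suc)
qed simp

text \<open>
  This is $\Gamma_p(x) \Gamma_p(1 - x) = \pm 1$ at $x = N \equiv -k$: modulo $p^n$ the factors
  $N + k - 1, \dots, N$ are $-1, \dots, -k$, and the value at $N + k \equiv 0$ is $1$.
\<close>

lemma morita_reflection:
  assumes "prime p" "odd p" "n \<ge> 1" "p ^ n dvd N + k"
  shows "[morita p N * morita p (Suc k) = (-1) ^ (k + 1 + k div p)] (mod int p ^ n)"
proof -
  have "[N + k = 0] (mod p ^ n)" using assms(4) by (simp add: cong_0_iff)
  hence 1: "[morita p (N + k) = 1] (mod int p ^ n)"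
    using morita_cong[OF assms(1-3)] morita_0 by metis
  have "int (p ^ n) dvd int (N + k)" using assms(4) of_nat_dvd_iff by blast
  hence d: "int p ^ n dvd int N + int k" by simp
  have "strip_pochhammer p (int N) k = (\<Prod>i<k. strip p (int N + int (k - Suc i)))"
    unfolding strip_pochhammer_def by (rule prod.nat_diff_reindex[symmetric])
  also have "[\<dots> = (\<Prod>i<k. strip p (- 1 - int i))] (mod int p ^ n)"
  proof (intro cong_prod)
    fix i assume "i \<in> {..<k}"
    hence "int N + int (k - Suc i) - (- 1 - int i) = int N + int k" by auto
    thus "[strip p (int N + int (k - Suc i)) = strip p (- 1 - int i)] (mod int p ^ n)"
      using strip_cong[of p n "int N + int (k - Suc i)" "- 1 - int i"] d assms(3)
      by (simp add: cong_iff_dvd_diff)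
  qed
  also have "(\<Prod>i<k. strip p (- 1 - int i)) = (-1) ^ (k + k div p) * strip_pochhammer p 1 k"
    using prime_gt_0_nat[OF assms(1)] by (rule prod_strip_uminus)
  finally have "[morita p N * (-1) ^ k * strip_pochhammer p (int N) k =
      morita p N * (-1) ^ k * ((-1) ^ (k + k div p) * strip_pochhammer p 1 k)] (mod int p ^ n)"
    by (intro cong_mult) auto
  with 1 have "[morita p N * (-1) ^ k * ((-1) ^ (k + k div p) * strip_pochhammer p 1 k) = 1] (mod int p ^ n)"
    unfolding morita_add by (metis cong_sym cong_trans)
  hence "[(-1) ^ (k + 1 + k div p) * (morita p N * (-1) ^ k * ((-1) ^ (k + k div p) * strip_pochhammer p 1 k))
     = (-1) ^ (k + 1 + k div p) * 1] (mod int p ^ n)"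
    by (intro cong_mult) auto
  also have "(-1) ^ (k + 1 + k div p) * (morita p N * (-1) ^ k * ((-1) ^ (k + k div p) * strip_pochhammer p 1 k))
     = morita p N * morita p (Suc k)"
    by (simp add: morita_Suc power_add mult_ac)
  finally show ?thesis by simp
qed

text \<open>
  The relation $A_k / A^{(1)}_m \equiv (-1)^l B_p(a,a)^{-1}$ for natural numbers, with denominators
  cleared.  Both sides are $1$: the left one is $\Gamma_p(N + k)^2$ with $N + k \equiv 0$, and the
  right one is, up to sign, $\Gamma_p(2N + k) \Gamma_p(1 + k)$ with $2N + k \equiv N$, to which the
  reflection formula applies.
\<close>

lemma strip_pochhammer_gamma_cong:
  assumes "prime p" "odd p" "n \<ge> 1" "p ^ n dvd N + k"
  shows "[(strip_pochhammer p (int N) k * morita p N) ^ 2 =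
     (-1) ^ (k + k div p) * morita p (2 * N) *
       (strip_pochhammer p 1 k * strip_pochhammer p (2 * int N) k)] (mod int p ^ n)"
proof -
  have "[N + k = 0] (mod p ^ n)" using assms(4) by (simp add: cong_0_iff)
  hence 1: "[morita p (N + k) = 1] (mod int p ^ n)"
    using morita_cong[OF assms(1-3)] morita_0 by metis
  have "(strip_pochhammer p (int N) k * morita p N) ^ 2 = morita p (N + k) ^ 2"
    by (simp add: morita_add power_mult_distrib flip: power_mult)
  also have "[\<dots> = 1 ^ 2] (mod int p ^ n)" by (rule cong_pow[OF 1])
  finally have L: "[(strip_pochhammer p (int N) k * morita p N) ^ 2 = 1] (mod int p ^ n)" by simp
  have "[2 * N + k = N] (mod p ^ n)"
    using assms(4) by (simp add: cong_altdef_nat mult_2)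
  hence 2: "[morita p (2 * N + k) = morita p N] (mod int p ^ n)"
    by (rule morita_cong[OF assms(1-3)])
  have "(-1) ^ (k + k div p) * morita p (2 * N) *
       (strip_pochhammer p 1 k * strip_pochhammer p (2 * int N) k) =
       (-1) ^ (k + 1 + k div p) * (morita p (2 * N + k) * morita p (Suc k))"
    by (simp add: morita_add morita_Suc power_add mult_ac)
  also have "[\<dots> = (-1) ^ (k + 1 + k div p) * (morita p N * morita p (Suc k))] (mod int p ^ n)"
    using 2 by (intro cong_mult) auto
  also have "[(-1) ^ (k + 1 + k div p) * (morita p N * morita p (Suc k)) =
     (-1) ^ (k + 1 + k div p) * (-1) ^ (k + 1 + k div p)] (mod int p ^ n)"
    by (intro cong_mult morita_reflection assms) auto
  also have "(-1) ^ (k + 1 + k div p) * (-1) ^ (k + 1 + k div p) = (1::int)"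
    by (simp flip: power_add)
  finally show ?thesis using L cong_sym cong_trans by blast
qed

section \<open>Completeness of the ring of Witt vectors and its units\<close>

lemma ghost_inj_upto:
  fixes s t :: "nat \<Rightarrow> 'v zpoly"
  assumes "prime p" "\<And>j. j \<le> n \<Longrightarrow> ghost p s j = ghost p t j"
  shows "s n = t n"
  using assms(2)
proof (induction n rule: less_induct)
  case (less n)
  hence "(\<Sum>i<n. of_nat p ^ i * s i ^ (p ^ (n - i))) = (\<Sum>i<n. of_nat p ^ i * t i ^ (p ^ (n - i)))"
    by (intro sum.cong) auto
  with less.prems[of n] have "of_nat (p ^ n) * s n = of_nat (p ^ n) * t n"
    by (simp add: ghost_split of_nat_power)
  moreover have "p ^ n > 0" using prime_gt_0_nat[OF assms(1)] by simp
  ultimately show ?case by (rule zpoly_of_nat_cancel)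
qed

text \<open>
  The ghost components up to index $n$ involve the components up to index $n$ only, and they
  determine these if multiples of $p$ can be cancelled.  As this fails in characteristic $p$, the
  argument is carried out for integer polynomials that specialise to the given vectors and share
  their variables up to index $n$.
\<close>

lemma wadd_local:
  fixes x x' y :: "nat \<Rightarrow> 'a::comm_ring_1"
  assumes "prime p" "\<And>i. i \<le> n \<Longrightarrow> x i = x' i"
  shows "wadd p x y n = wadd p x' y n"
proof -
  define f where "f = (\<lambda>(j::nat, i). if j = 0 then x i else if j = 1 then y i else x' i)"
  define xs where "xs = (\<lambda>i::nat. zvar (0::nat, i))"
  define ys where "ys = (\<lambda>i::nat. zvar (1::nat, i))"
  define xs' where "xs' = (\<lambda>i::nat. if i \<le> n then zvar (0::nat, i) else zvar (2, i))"
  have lift: "x = zeval f \<circ> xs" "y = zeval f \<circ> ys" "x' = zeval f \<circ> xs'"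
    using assms(2) by (auto simp: f_def xs_def ys_def xs'_def fun_eq_iff)
  have "ghost p xs j = ghost p xs' j" if "j \<le> n" for j
    unfolding ghost_def using that by (intro sum.cong) (auto simp: xs_def xs'_def)
  hence "ghost p (wadd p xs ys) j = ghost p (wadd p xs' ys) j" if "j \<le> n" for j
    using that by (simp add: ghost_wadd assms(1))
  hence "wadd p xs ys n = wadd p xs' ys n"
    by (rule ghost_inj_upto[OF assms(1)])
  thus ?thesis unfolding lift zeval_wops by simp
qed

lemma witt_coeff_add_local:
  fixes x x' y :: "'k::comm_ring_prime_char witt"
  assumes "\<And>i. i \<le> n \<Longrightarrow> witt_coeff x i = witt_coeff x' i"
  shows "witt_coeff (x + y) n = witt_coeff (x' + y) n"
  unfolding plus_witt.rep_eq by (rule wadd_local) (simp_all add: assms)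

lemma CHAR_power_dvd_witt_iff:
  fixes x :: "'k::{alg_closed_field, field_prime_char} witt"
  shows "of_nat CHAR('k) ^ n dvd x \<longleftrightarrow> (\<forall>i<n. witt_coeff x i = 0)"
proof
  assume "of_nat CHAR('k) ^ n dvd x"
  thus "\<forall>i<n. witt_coeff x i = 0"
    by (auto simp only: witt_coeff_CHAR_power_mult elim!: dvdE) simp
next
  assume *: "\<forall>i<n. witt_coeff x i = 0"
  show "of_nat CHAR('k) ^ n dvd x"
  proof (cases "x = 0")
    case False
    then obtain k u where ku: "x = of_nat CHAR('k) ^ k * u" "witt_coeff u 0 \<noteq> 0"
      by (rule witt_factor)
    have "witt_coeff x k \<noteq> 0" by (simp add: ku witt_coeff_CHAR_power_mult)
    with * have "n \<le> k" by (meson not_le)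
    thus ?thesis unfolding ku(1) by (intro dvd_mult2 le_imp_power_dvd)
  qed simp
qed

text \<open>
  By locality of addition, $x = (x - y) + y$ has the leading components of $y$ if those of
  $x - y$ vanish, and $x - y = x + (-y)$ has those of $y + (-y) = 0$ if $x$ and $y$ share theirs.
\<close>

lemma witt_cong_iff_coeff:
  fixes x y :: "'k::{alg_closed_field, field_prime_char} witt"
  shows "of_nat CHAR('k) ^ n dvd x - y \<longleftrightarrow> (\<forall>i<n. witt_coeff x i = witt_coeff y i)"
proof
  assume "of_nat CHAR('k) ^ n dvd x - y"
  hence "witt_coeff ((x - y) + y) i = witt_coeff (0 + y) i" if "i < n" for i
    using that by (intro witt_coeff_add_local) (simp add: CHAR_power_dvd_witt_iff)
  thus "\<forall>i<n. witt_coeff x i = witt_coeff y i" by simp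
next
  assume "\<forall>i<n. witt_coeff x i = witt_coeff y i"
  hence "witt_coeff (x + - y) i = witt_coeff (y + - y) i" if "i < n" for i
    using that by (intro witt_coeff_add_local) simp
  thus "of_nat CHAR('k) ^ n dvd x - y"
    by (simp add: CHAR_power_dvd_witt_iff)
qed

text \<open>
  The limit is read off diagonally, since the $i$-th component is constant from the term with
  index $i + 1$ on.
\<close>

lemma witt_complete:
  fixes x :: "nat \<Rightarrow> 'k::{alg_closed_field, field_prime_char} witt"
  assumes "\<And>n. of_nat CHAR('k) ^ n dvd x (Suc n) - x n"
  shows "\<exists>w. \<forall>n. of_nat CHAR('k) ^ n dvd x n - w"
proof -
  have cauchy: "of_nat CHAR('k) ^ m dvd x (m + j) - x m" for m j
  proof (induction j)
    case (Suc j)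
    have "of_nat CHAR('k) ^ m dvd x (Suc (m + j)) - x (m + j)"
      using assms[of "m + j"] by (rule dvd_trans[OF le_imp_power_dvd, rotated]) simp
    from dvd_diff_trans[OF this Suc] show ?case by simp
  qed simp
  define w where "w = Witt (\<lambda>i. witt_coeff (x (Suc i)) i)"
  have "witt_coeff (x n) i = witt_coeff w i" if "i < n" for i n
  proof -
    have "of_nat CHAR('k) ^ Suc i dvd x n - x (Suc i)"
      using cauchy[of "Suc i" "n - Suc i"] that by simp
    hence "witt_coeff (x n) i = witt_coeff (x (Suc i)) i"
      unfolding witt_cong_iff_coeff by blast
    thus ?thesis by (simp add: w_def Witt_inverse)
  qed
  thus ?thesis using witt_cong_iff_coeff by blast
qed

text \<open>
  An inverse modulo $p$ is the Witt vector with the single component $x_0^{-1}$; it is corrected by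
  a geometric series, which converges by completeness.
\<close>

lemma witt_unit:
  fixes x :: "'k::{alg_closed_field, field_prime_char} witt"
  assumes "\<not> of_nat CHAR('k) dvd x"
  shows "x dvd 1"
proof -
  have "witt_coeff x 0 \<noteq> 0"
    using assms CHAR_power_dvd_witt_iff[of 1 x] by auto
  define y where "y = (Witt (\<lambda>i. if i = 0 then inverse (witt_coeff x 0) else 0) :: 'k witt)"
  define r where "r = 1 - x * y"
  have "witt_coeff (1 :: 'k witt) 0 = witt_coeff (x * y) 0"
    using \<open>witt_coeff x 0 \<noteq> 0\<close>
    by (simp add: witt_coeff_mult_0 y_def Witt_inverse one_witt.rep_eq wone_def)
  hence r: "of_nat CHAR('k) dvd r"
    using witt_cong_iff_coeff[of 1 1 "x * y"] by (simp add: r_def)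
  define s where "s n = (\<Sum>i<n. r ^ i)" for n
  have "of_nat CHAR('k) ^ n dvd s (Suc n) - s n" for n
    using dvd_power_same[OF r] by (simp add: s_def)
  then obtain w where w: "\<And>n. of_nat CHAR('k) ^ n dvd s n - w"
    using witt_complete by blast
  have "of_nat CHAR('k) ^ n dvd x * y * w - 1" for n
  proof -
    have "(1 - r) * s n = 1 - r ^ n"
      unfolding s_def by (simp add: one_diff_power_eq)
    hence "x * y * s n - 1 = - (r ^ n)" by (simp add: r_def)
    hence "of_nat CHAR('k) ^ n dvd x * y * s n - 1"
      using dvd_power_same[OF r] by simp
    moreover have "of_nat CHAR('k) ^ n dvd x * y * w - x * y * s n"
      using dvd_mult[OF dvd_diff_sym[OF w[of n]], of "x * y"] by (simp add: algebra_simps)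
    ultimately show ?thesis using dvd_diff_trans by blast
  qed
  hence "x * y * w - 1 = 0" by (rule CHAR_power_separated)
  hence "1 = x * (y * w)" by (simp add: mult.assoc)
  thus ?thesis by (rule dvdI)
qed

section \<open>Limits along natural numbers\<close>

lemma CHAR_power_dvd_of_int_witt:
  "int CHAR('k) ^ n dvd m \<Longrightarrow>
    (of_nat CHAR('k) :: 'k::{alg_closed_field, field_prime_char} witt) ^ n dvd of_int m"
  by (elim dvdE) simp

lemma CHAR_power_dvd_of_int_witt_iff:
  "(of_nat CHAR('k) :: 'k::{alg_closed_field, field_prime_char} witt) ^ n dvd of_int m \<longleftrightarrow>
    int CHAR('k) ^ n dvd m"
proof
  show "int CHAR('k) ^ n dvd m" if "(of_nat CHAR('k) :: 'k witt) ^ n dvd of_int m"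
    using that
  proof (induction n arbitrary: m)
    case (Suc n)
    let ?p = "of_nat CHAR('k) :: 'k witt"
    have "?p dvd of_int m" using Suc.prems unfolding power_Suc by (rule dvd_mult_left)
    then obtain j where j: "m = int CHAR('k) * j"
      by (auto simp only: CHAR_dvd_of_int_witt_iff elim: dvdE)
    have "?p * ?p ^ n dvd ?p * of_int j" using Suc.prems by (simp add: j)
    hence "?p ^ n dvd of_int j"
      using of_nat_CHAR_witt_nonzero[where ?'k = 'k] by (simp only: dvd_mult_cancel_left) simp
    with Suc.IH show ?case by (simp add: j)
  qed simp
qed (rule CHAR_power_dvd_of_int_witt)

lemma padic_ints_nat_approx:
  fixes z :: "'k::{alg_closed_field, field_prime_char} witt"
  assumes "z \<in> padic_ints"
  obtains m :: nat where "of_nat CHAR('k) ^ n dvd of_nat m - z"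
proof -
  obtain j where j: "of_nat CHAR('k) ^ n dvd z - of_int j"
    using assms unfolding padic_ints_def by blast
  define m where "m = nat (j mod int CHAR('k) ^ n)"
  have "int m = j mod int CHAR('k) ^ n" by (simp add: m_def)
  hence "int CHAR('k) ^ n dvd int m - j" by (simp add: mod_eq_dvd_iff[symmetric])
  from CHAR_power_dvd_of_int_witt[OF this]
  have "of_nat CHAR('k) ^ n dvd of_nat m - (of_int j :: 'k witt)" by simp
  from dvd_diff_trans[OF this dvd_diff_sym[OF j]] show ?thesis by (rule that)
qed

text \<open>
  For a function that preserves congruences the limit is as close to each value as the argument is
  to $z$.  This provides both the existence of the limit and the only property of $\Gamma_p$ and
  $c^z$ that is needed later.
\<close>

lemma padic_lim_cong:
  fixes f :: "nat \<Rightarrow> 'k::{alg_closed_field, field_prime_char} witt"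
  assumes lipschitz: "\<And>n i j. n \<ge> 1 \<Longrightarrow> [i = j] (mod CHAR('k) ^ n) \<Longrightarrow> of_nat CHAR('k) ^ n dvd f i - f j"
    and z: "z \<in> padic_ints" and n: "n \<ge> 1" and m: "of_nat CHAR('k) ^ n dvd of_nat m - z"
  shows "of_nat CHAR('k) ^ n dvd f m - padic_lim f z"
proof -
  let ?p = "of_nat CHAR('k) :: 'k witt"
  have lip: "?p ^ n dvd f i - f j"
    if ij: "n \<ge> 1" "?p ^ n dvd of_nat i - z" "?p ^ n dvd of_nat j - z" for n i j
  proof -
    have "?p ^ n dvd of_nat i - of_nat j" using dvd_diff_trans[OF ij(2) dvd_diff_sym[OF ij(3)]] .
    hence "?p ^ n dvd of_int (int i - int j)" by simp
    hence "[int i = int j] (mod int (CHAR('k) ^ n))"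
      unfolding CHAR_power_dvd_of_int_witt_iff by (simp add: cong_iff_dvd_diff)
    thus ?thesis using lipschitz ij(1) cong_int_iff by blast
  qed
  have "\<exists>m. ?p ^ n dvd of_nat m - z" for n
    using padic_ints_nat_approx[OF z, of n] by metis
  then obtain a where a: "\<And>n. ?p ^ n dvd of_nat (a n) - z" by metis
  have le: "?p ^ i dvd x" if "?p ^ j dvd x" "i \<le> j" for i j x
    using that le_imp_power_dvd dvd_trans by blast
  have "?p ^ n dvd f (a (Suc n)) - f (a n)" for n
  proof (cases "n = 0")
    case False
    thus ?thesis using lip[of n "a (Suc n)" "a n"] a le[OF a[of "Suc n"]] by simp
  qed simp
  then obtain w where w: "\<And>n. ?p ^ n dvd f (a n) - w"
    using witt_complete[of "\<lambda>n. f (a n)"] by blast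
  have fw: "?p ^ n dvd f m - w" if "n \<ge> 1" "?p ^ n dvd of_nat m - z" for n m
    using dvd_diff_trans[OF lip[OF that a] w] .
  have "padic_lim f z = w"
    unfolding padic_lim_def
  proof (rule the_equality)
    show "\<forall>n. \<exists>N. \<forall>m. ?p ^ N dvd of_nat m - z \<longrightarrow> ?p ^ n dvd f m - w"
    proof
      fix n
      have "?p ^ n dvd f m - w" if "?p ^ Suc n dvd of_nat m - z" for m
        using le[OF fw[OF _ that]] by simp
      thus "\<exists>N. \<forall>m. ?p ^ N dvd of_nat m - z \<longrightarrow> ?p ^ n dvd f m - w" by blast
    qed
  next
    fix w' assume w': "\<forall>n. \<exists>N. \<forall>m. ?p ^ N dvd of_nat m - z \<longrightarrow> ?p ^ n dvd f m - w'"
    have "?p ^ n dvd w' - w" for n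
    proof -
      obtain N where N: "\<And>m. ?p ^ N dvd of_nat m - z \<Longrightarrow> ?p ^ n dvd f m - w'" using w' by blast
      let ?m = "a (Suc (max N n))"
      have "?p ^ n dvd f ?m - w'" using N le[OF a[of "Suc (max N n)"], of N] by simp
      moreover have "?p ^ n dvd f ?m - w" using le[OF w[of "Suc (max N n)"], of n] by simp
      ultimately show ?thesis using dvd_diff_trans dvd_diff_sym by blast
    qed
    hence "w' - w = 0" by (rule CHAR_power_separated)
    thus "w' = w" by simp
  qed
  thus ?thesis using fw n m by simp
qed

lemma power_cong_1:
  fixes c :: "'a::comm_ring_1"
  assumes "of_nat p dvd c - 1"
  shows "of_nat p ^ Suc n dvd c ^ (p ^ n * j) - 1"
proof -
  have "of_nat p ^ 1 dvd c ^ j - 1 ^ j"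
    using assms power_diff_sumr2[of c j 1] by simp
  hence "of_nat p ^ (1 + n) dvd (c ^ j) ^ (p ^ n) - (1 ^ j) ^ (p ^ n)"
    by (intro dvd_power_lift) simp_all
  thus ?thesis by (simp add: mult.commute flip: power_mult)
qed

text \<open>
  The exponent $e$ may be replaced by a natural number $m \equiv e$ modulo $p^{n+1}$; then
  $p^n \mid m$, and each $p$-th power gains one factor $p$ in the distance to $1$.
\<close>

lemma padic_power_cong_1:
  fixes c e :: "'k::{alg_closed_field, field_prime_char} witt"
  assumes c: "of_nat CHAR('k) dvd c - 1" and e: "e \<in> padic_ints" "of_nat CHAR('k) ^ n dvd e"
  shows "of_nat CHAR('k) ^ Suc n dvd padic_power c e - 1"
proof -
  let ?p = "of_nat CHAR('k) :: 'k witt"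
  have lip: "?p ^ n dvd c ^ i - c ^ j" if ij: "[i = j] (mod CHAR('k) ^ n)" for n i j
  proof -
    have *: "?p ^ n dvd c ^ j - c ^ i" if "i \<le> j" "[i = j] (mod CHAR('k) ^ n)" for i j
    proof -
      have "CHAR('k) ^ n dvd j - i" using that by (metis cong_altdef_nat cong_sym)
      then obtain d where d: "j - i = CHAR('k) ^ n * d" by (elim dvdE)
      have "j = i + CHAR('k) ^ n * d" using that(1) d by simp
      hence "c ^ j - c ^ i = c ^ i * (c ^ (CHAR('k) ^ n * d) - 1)"
        by (simp add: power_add right_diff_distrib)
      moreover have "?p ^ n dvd c ^ (CHAR('k) ^ n * d) - 1"
        using power_cong_1[OF c, of n d] by (rule dvd_trans[OF le_imp_power_dvd, rotated]) simp
      ultimately show ?thesis by simp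
    qed
    show ?thesis using *[of i j] *[of j i] ij cong_sym dvd_diff_sym nat_le_linear by metis
  qed
  obtain m where m: "?p ^ Suc n dvd of_nat m - e" using padic_ints_nat_approx[OF e(1)] .
  have "?p ^ n dvd of_nat m - e" using m by (rule dvd_trans[OF le_imp_power_dvd, rotated]) simp
  from dvd_add[OF this e(2)] have "?p ^ n dvd of_int (int m)" by simp
  hence "CHAR('k) ^ n dvd m"
    unfolding CHAR_power_dvd_of_int_witt_iff by (metis of_nat_dvd_iff of_nat_power)
  then obtain d where "m = CHAR('k) ^ n * d" by (elim dvdE)
  hence "?p ^ Suc n dvd c ^ m - 1" using power_cong_1[OF c, of n d] by simp
  moreover have "?p ^ Suc n dvd c ^ m - padic_power c e"
    unfolding padic_power_def by (rule padic_lim_cong) (use lip e m in auto)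
  ultimately show ?thesis using dvd_diff_sym dvd_diff_trans by blast
qed

section \<open>Digits and the Dwork prime\<close>

lemma dwork_shift_eqI:
  fixes a :: "'k::{alg_closed_field, field_prime_char} witt"
  assumes "l < CHAR('k)" "of_nat CHAR('k) dvd a + of_nat l"
  shows "dwork_shift a = l"
  unfolding dwork_shift_def
proof (rule the_equality)
  fix l' assume l': "l' < CHAR('k) \<and> of_nat CHAR('k) dvd a + of_nat l'"
  have "(of_nat CHAR('k) :: 'k witt) dvd (a + of_nat l') - (a + of_nat l)"
    using l' assms by (intro dvd_diff) auto
  also have "(a + of_nat l') - (a + of_nat l) = of_int (int l' - int l)" by simp
  finally have "int CHAR('k) dvd int l' - int l" by (simp only: CHAR_dvd_of_int_witt_iff)
  hence "int l' mod int CHAR('k) = int l mod int CHAR('k)" by (simp add: mod_eq_dvd_iff)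
  with l' assms show "l' = l" by simp
qed (use assms in simp)

lemma dwork_prime_eqI:
  fixes a b :: "'k::{alg_closed_field, field_prime_char} witt"
  assumes "of_nat CHAR('k) * b = a + of_nat (dwork_shift a)"
  shows "dwork_prime a = b"
  unfolding dwork_prime_def
proof (rule the_equality)
  fix b' assume "of_nat CHAR('k) * b' = a + of_nat (dwork_shift a)"
  hence "of_nat CHAR('k) * b' = of_nat CHAR('k) * b" using assms by simp
  thus "b' = b" using of_nat_CHAR_witt_nonzero[where ?'k = 'k] mult_left_cancel by blast
qed (rule assms)

lemma CHAR_dvd_padic_add_of_nat_iff:
  fixes a :: "'k::{alg_closed_field, field_prime_char} witt"
  assumes "a \<in> padic_ints"
  shows "of_nat CHAR('k) dvd a + of_nat k \<longleftrightarrow> int CHAR('k) dvd int k - int (dwork_shift a)"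
proof -
  have "a + of_nat k = (a + of_nat (dwork_shift a)) + of_int (int k - int (dwork_shift a))" by simp
  thus ?thesis
    using dvd_add_right_iff[OF dwork_shift_props(2)[OF assms]] CHAR_dvd_of_int_witt_iff by metis
qed

lemma funpow_dwork_prime_padic_int:
  "a \<in> padic_ints \<Longrightarrow> (dwork_prime ^^ i) a \<in> padic_ints"
  by (induction i) (simp_all add: dwork_prime_padic_int)

text \<open>
  Since $\alpha + l_\alpha = p \alpha'$, the first digit of $-\alpha$ is $l_\alpha$ and the
  remaining ones are the digits of $-\alpha'$.
\<close>

lemma padic_digit_eq:
  fixes a :: "'k::{alg_closed_field, field_prime_char} witt"
  assumes a: "a \<in> padic_ints"
  shows "padic_digit a = (\<lambda>i. dwork_shift ((dwork_prime ^^ i) a))"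
  unfolding padic_digit_def
proof (rule the_equality)
  let ?p = "of_nat CHAR('k) :: 'k witt"
  let ?d = "\<lambda>i. dwork_shift ((dwork_prime ^^ i) a)"
  have eq: "a + (\<Sum>i<n. of_nat (?d i) * ?p ^ i) = ?p ^ n * (dwork_prime ^^ n) a" for n
  proof (induction n)
    case (Suc n)
    have "a + (\<Sum>i<Suc n. of_nat (?d i) * ?p ^ i) = ?p ^ n * ((dwork_prime ^^ n) a + of_nat (?d n))"
      using Suc by (simp add: algebra_simps)
    also have "\<dots> = ?p ^ Suc n * (dwork_prime ^^ Suc n) a"
      by (simp add: dwork_prime_eq[OF funpow_dwork_prime_padic_int[OF a], symmetric])
    finally show ?case .
  qed simp
  have lt: "?d i < CHAR('k)" for i
    by (rule dwork_shift_props(1)[OF funpow_dwork_prime_padic_int[OF a]])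
  have dvd: "?p ^ n dvd a + (\<Sum>i<n. of_nat (?d i) * ?p ^ i)" for n
    unfolding eq by simp
  show "(\<forall>i. ?d i < CHAR('k)) \<and> (\<forall>n. ?p ^ n dvd a + (\<Sum>i<n. of_nat (?d i) * ?p ^ i))"
    using lt dvd by blast
  fix d' assume d': "(\<forall>i. d' i < CHAR('k)) \<and> (\<forall>n. ?p ^ n dvd a + (\<Sum>i<n. of_nat (d' i) * ?p ^ i))"
  have "d' n = ?d n" for n
  proof (induction n rule: less_induct)
    case (less n)
    hence S: "(\<Sum>i<n. of_nat (d' i) * ?p ^ i) = (\<Sum>i<n. of_nat (?d i) * ?p ^ i)" by simp
    have "?p ^ Suc n dvd (a + (\<Sum>i<Suc n. of_nat (d' i) * ?p ^ i)) - (a + (\<Sum>i<Suc n. of_nat (?d i) * ?p ^ i))"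
      using d' dvd by (intro dvd_diff) blast+
    also have "\<dots> = ?p ^ n * of_int (int (d' n) - int (?d n))"
      by (simp add: S algebra_simps)
    finally have "?p ^ n * ?p dvd ?p ^ n * of_int (int (d' n) - int (?d n))" by (simp add: mult.commute)
    hence "?p dvd of_int (int (d' n) - int (?d n))"
      using of_nat_CHAR_witt_nonzero[where ?'k = 'k] by (simp only: dvd_mult_cancel_left) simp
    hence "int (d' n) mod int CHAR('k) = int (?d n) mod int CHAR('k)"
      unfolding CHAR_dvd_of_int_witt_iff by (simp add: mod_eq_dvd_iff)
    thus ?case using d' lt[of n] by simp
  qed
  thus "d' = ?d" by (rule ext)
qed

text \<open>
  The residue $l_{2a}$ is $2 l_a$ or $2 l_a - p$, and the latter is smaller than $l_a$.
\<close>

lemma dwork_shift_prime_double: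
  fixes a :: "'k::{alg_closed_field, field_prime_char} witt"
  assumes a: "a \<in> padic_ints" and less: "dwork_shift a < dwork_shift (2 * a)"
  shows "dwork_shift a > 0" "dwork_shift (2 * a) = 2 * dwork_shift a"
    "dwork_prime (2 * a) = 2 * dwork_prime a"
proof -
  let ?l = "dwork_shift a"
  have lt: "?l < CHAR('k)" and dvd: "of_nat CHAR('k) dvd a + of_nat ?l"
    using dwork_shift_props[OF a] by auto
  have dvd2: "of_nat CHAR('k) dvd 2 * a + of_nat (2 * ?l)"
    using dvd_mult[OF dvd, of 2] by (simp add: algebra_simps)
  have "2 * ?l < CHAR('k)"
  proof (rule ccontr)
    assume "\<not> 2 * ?l < CHAR('k)"
    hence ge: "CHAR('k) \<le> 2 * ?l" by simp
    have "of_nat CHAR('k) dvd (2 * a + of_nat (2 * ?l)) - of_nat CHAR('k)"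
      using dvd2 by (intro dvd_diff) simp_all
    also have "\<dots> = 2 * a + of_nat (2 * ?l - CHAR('k))"
      using ge by (simp only: of_nat_diff add_diff_eq)
    finally have "dwork_shift (2 * a) = 2 * ?l - CHAR('k)"
      using lt by (intro dwork_shift_eqI) simp_all
    with less lt ge show False by simp
  qed
  with dvd2 show 2: "dwork_shift (2 * a) = 2 * ?l" by (intro dwork_shift_eqI)
  with less show "?l > 0" by simp
  have "of_nat CHAR('k) * (2 * dwork_prime a) = 2 * (of_nat CHAR('k) * dwork_prime a)" by simp
  also have "\<dots> = 2 * a + of_nat (dwork_shift (2 * a))"
    by (simp only: 2 dwork_prime_eq[OF a]) (simp add: algebra_simps)
  finally show "dwork_prime (2 * a) = 2 * dwork_prime a" by (rule dwork_prime_eqI)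
qed

definition digit_dominated :: "'k::{alg_closed_field, field_prime_char} witt \<Rightarrow> bool" where
  "digit_dominated a \<longleftrightarrow> a \<in> padic_ints \<and> (\<forall>i. padic_digit a i < padic_digit (2 * a) i)"

lemma double_padic_int: "a \<in> padic_ints \<Longrightarrow> 2 * a \<in> padic_ints"
  using padic_ints_closed[of a a] by (simp flip: mult_2)

lemma digit_dominated_props:
  fixes a :: "'k::{alg_closed_field, field_prime_char} witt"
  assumes "digit_dominated a"
  shows "a \<in> padic_ints" "dwork_shift a > 0" "dwork_shift (2 * a) = 2 * dwork_shift a"
    "dwork_prime (2 * a) = 2 * dwork_prime a" "digit_dominated (dwork_prime a)"
proof -
  show a: "a \<in> padic_ints" using assms by (simp add: digit_dominated_def)
  have dig: "dwork_shift ((dwork_prime ^^ i) a) < dwork_shift ((dwork_prime ^^ i) (2 * a))" for i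
    using assms padic_digit_eq[OF a] padic_digit_eq[OF double_padic_int[OF a]]
    by (simp add: digit_dominated_def)
  have "dwork_shift a < dwork_shift (2 * a)" using dig[of 0] by simp
  note * = dwork_shift_prime_double[OF a this]
  show "dwork_shift a > 0" "dwork_shift (2 * a) = 2 * dwork_shift a"
    "dwork_prime (2 * a) = 2 * dwork_prime a" by (rule *)+
  note a' = dwork_prime_padic_int[OF a]
  have "dwork_shift ((dwork_prime ^^ i) (dwork_prime a)) < dwork_shift ((dwork_prime ^^ i) (2 * dwork_prime a))" for i
    using dig[of "Suc i"] unfolding funpow_Suc_right o_apply *(3) .
  thus "digit_dominated (dwork_prime a)"
    using a' padic_digit_eq[OF a'] padic_digit_eq[OF double_padic_int[OF a']]
    by (simp add: digit_dominated_def)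
qed

text \<open>
  If $x + i = 0$, then $i = l_x + pj$ and $x' + j = 0$ with $j < i$, because $l_x > 0$.  So a
  descent excludes this for $x = a$ and $x = 2a$: no digit of $-a$ or $-2a$ vanishes, whereas all but
  finitely many digits of a natural number do.
\<close>

lemma add_of_nat_nonzero:
  fixes a :: "'k::{alg_closed_field, field_prime_char} witt"
  assumes "digit_dominated a"
  shows "a + of_nat i \<noteq> 0 \<and> 2 * a + of_nat i \<noteq> 0"
  using assms
proof (induction i arbitrary: a rule: less_induct)
  case (less i)
  note props = digit_dominated_props[OF less.prems]
  have *: False if z: "x \<in> padic_ints" "dwork_shift x > 0" "x + of_nat i = 0"
    "\<And>j. j < i \<Longrightarrow> dwork_prime x + of_nat j \<noteq> 0" for x :: "'k witt"
  proof -
    have "of_nat CHAR('k) dvd x + of_nat i" using z(3) by simp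
    hence d: "int CHAR('k) dvd int i - int (dwork_shift x)"
      by (simp only: CHAR_dvd_padic_add_of_nat_iff[OF z(1)])
    then obtain t where t: "int i - int (dwork_shift x) = int CHAR('k) * t" by (elim dvdE)
    have "int (dwork_shift x) < int CHAR('k)" using dwork_shift_props(1)[OF z(1)] by simp
    hence "int CHAR('k) * t > int CHAR('k) * (-1)" using t by linarith
    hence "t \<ge> 0" by (simp only: mult_less_cancel_left) auto
    define j where "j = nat t"
    have j: "i = dwork_shift x + CHAR('k) * j"
      using t \<open>t \<ge> 0\<close> by (metis add.commute diff_add_cancel int_nat_eq j_def of_nat_add of_nat_eq_iff of_nat_mult)
    have "1 * j \<le> CHAR('k) * j"
      by (intro mult_le_mono1) (use dwork_shift_props(1)[OF z(1)] in linarith)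
    hence "j < i" using z(2) by (subst j) linarith
    have "x + of_nat i = (x + of_nat (dwork_shift x)) + of_nat CHAR('k) * of_nat j"
      by (subst j) (simp only: of_nat_add of_nat_mult add.assoc)
    also have "\<dots> = of_nat CHAR('k) * (dwork_prime x + of_nat j)"
      by (simp only: dwork_prime_eq[OF z(1), symmetric] distrib_left)
    finally have "of_nat CHAR('k) * (dwork_prime x + of_nat j) = 0" using z(3) by simp
    thus False
      using z(4)[OF \<open>j < i\<close>] of_nat_CHAR_witt_nonzero[where ?'k = 'k] unfolding mult_eq_0_iff by blast
  qed
  have IH: "dwork_prime a + of_nat j \<noteq> 0" "dwork_prime (2 * a) + of_nat j \<noteq> 0" if "j < i" for j
    using less.IH[OF that props(5)] by (simp_all add: props(4))
  have "dwork_shift (2 * a) > 0" using props(2,3) by simp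
  from *[OF double_padic_int[OF props(1)] this _ IH(2)] *[OF props(1,2) _ IH(1)]
  show ?case by blast
qed


section \<open>Dwork's factorisation of Pochhammer symbols\<close>

text \<open>
  The number of $i < k$ with $i \equiv l$ modulo $p$ is $\lfloor (k + p - 1 - l) / p \rfloor$.
\<close>

lemma multiple_count_Suc:
  fixes k l p :: nat
  assumes "l < p"
  shows "(Suc k + (p - 1 - l)) div p =
    (if int p dvd int k - int l then Suc ((k + (p - 1 - l)) div p) else (k + (p - 1 - l)) div p)"
proof -
  have "int k - int l + int p = int (Suc (k + (p - 1 - l)))" using assms by simp
  hence "int p dvd int k - int l \<longleftrightarrow> p dvd Suc (k + (p - 1 - l))"
    by (metis dvd_add_left_iff dvd_refl of_nat_dvd_iff)
  thus ?thesis by (simp add: div_Suc dvd_eq_mod_eq_0)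
qed

lemma multiple_count_block:
  fixes q m l p :: nat
  assumes "l < p" "q \<le> p"
  shows "(q + p * m + (p - 1 - l)) div p = (if l < q then Suc m else m)"
proof (cases "l < q")
  case True
  have "q + p * m + (p - 1 - l) = (q - 1 - l) + p * Suc m" using True assms by simp
  moreover have "q - 1 - l < p" using assms True by simp
  ultimately show ?thesis using True by (simp only: div_mult_self2) simp
next
  case False
  have "q + p * m + (p - 1 - l) = (q + (p - 1 - l)) + p * m" by simp
  moreover have "q + (p - 1 - l) < p" using assms False by simp
  ultimately show ?thesis using False by (simp only: div_mult_self2) simp
qed

text \<open>
  The factor $a + k$ is a multiple of $p$ exactly if $k = l_a + pj$, and then it is $p (a' + j)$,
  where $j$ is the number of earlier multiples.
\<close>

lemma pochhammer_dwork:
  fixes a :: "'k::{alg_closed_field, field_prime_char} witt"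
  assumes a: "a \<in> padic_ints"
  defines "cnt k \<equiv> (k + (CHAR('k) - 1 - dwork_shift a)) div CHAR('k)"
  shows "pochhammer a k = strip_pochhammer CHAR('k) a k *
    (of_nat CHAR('k) ^ cnt k * pochhammer (dwork_prime a) (cnt k))"
proof (induction k)
  case 0
  have "dwork_shift a < CHAR('k)" using dwork_shift_props(1)[OF a] .
  hence "cnt 0 = 0" by (simp add: cnt_def)
  thus ?case by simp
next
  case (Suc k)
  let ?l = "dwork_shift a" and ?p = "CHAR('k)"
  note cnt_Suc = multiple_count_Suc[OF dwork_shift_props(1)[OF a], of k, folded cnt_def]
  show ?case
  proof (cases "int ?p dvd int k - int ?l")
    case True
    hence c: "cnt (Suc k) = Suc (cnt k)" using cnt_Suc by simp
    have "of_nat ?p dvd a + of_nat k" using True CHAR_dvd_padic_add_of_nat_iff[OF a] by blast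
    hence s: "strip_pochhammer ?p a (Suc k) = strip_pochhammer ?p a k"
      by (simp add: strip_pochhammer_Suc strip_def)
    have "int k - int ?l = int ?p * int (cnt k)"
    proof -
      have lt: "?l < ?p" by (rule dwork_shift_props(1)[OF a])
      have "int k - int ?l + int ?p = int (Suc (k + (?p - 1 - ?l)))" using lt by simp
      hence "?p dvd Suc (k + (?p - 1 - ?l))"
        using True by (metis dvd_add_left_iff dvd_refl of_nat_dvd_iff)
      hence "Suc (k + (?p - 1 - ?l)) = ?p * cnt (Suc k)" by (simp add: cnt_def)
      hence "int k - int ?l + int ?p = int ?p * int (cnt (Suc k))"
        using \<open>int k - int ?l + int ?p = _\<close> by (metis of_nat_mult)
      thus ?thesis by (simp add: c distrib_left)
    qed
    hence "int k = int (?l + ?p * cnt k)" by simp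
    hence "k = ?l + ?p * cnt k" by (simp only: of_nat_eq_iff)
    hence "a + of_nat k = (a + of_nat ?l) + of_nat ?p * of_nat (cnt k)"
      by (metis add.assoc of_nat_add of_nat_mult)
    also have "\<dots> = of_nat ?p * (dwork_prime a + of_nat (cnt k))"
      by (simp only: dwork_prime_eq[OF a, symmetric] distrib_left)
    finally have k: "a + of_nat k = of_nat ?p * (dwork_prime a + of_nat (cnt k))" .
    show ?thesis by (simp add: pochhammer_Suc Suc c s k mult_ac)
  next
    case False
    hence c: "cnt (Suc k) = cnt k" using cnt_Suc by simp
    have "\<not> of_nat ?p dvd a + of_nat k" using False CHAR_dvd_padic_add_of_nat_iff[OF a] by blast
    hence "strip_pochhammer ?p a (Suc k) = strip_pochhammer ?p a k * (a + of_nat k)"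
      by (simp add: strip_pochhammer_Suc strip_def)
    thus ?thesis by (simp add: pochhammer_Suc Suc c mult_ac)
  qed
qed

lemma pochhammer_dwork_block:
  fixes a :: "'k::{alg_closed_field, field_prime_char} witt" and q m :: nat
  assumes "a \<in> padic_ints" "q \<le> CHAR('k)"
  defines "c \<equiv> (if dwork_shift a < q then Suc m else m)"
  shows "pochhammer a (q + CHAR('k) * m) = strip_pochhammer CHAR('k) a (q + CHAR('k) * m) *
    (of_nat CHAR('k) ^ c * pochhammer (dwork_prime a) c)"
  using pochhammer_dwork[OF assms(1), of "q + CHAR('k) * m"]
  unfolding multiple_count_block[OF dwork_shift_props(1)[OF assms(1)] assms(2)] c_def .

lemma of_nat_padic_int: "of_nat k \<in> (padic_ints :: 'k::{alg_closed_field, field_prime_char} witt set)"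
  unfolding padic_ints_def
proof safe
  show "\<exists>m. of_nat CHAR('k) ^ n dvd (of_nat k :: 'k witt) - of_int m" for n
    by (rule exI[of _ "int k"]) simp
qed

lemma one_padic_int: "1 \<in> (padic_ints :: 'k::{alg_closed_field, field_prime_char} witt set)"
  using of_nat_padic_int[of 1] by simp

lemma dwork_shift_1: "dwork_shift (1 :: 'k::{alg_closed_field, field_prime_char} witt) = CHAR('k) - 1"
  and dwork_prime_1: "dwork_prime (1 :: 'k witt) = 1"
proof -
  have "CHAR('k) > 0" using dwork_shift_props(1)[OF one_padic_int, where ?'k = 'k] by linarith
  hence 1: "1 + of_nat (CHAR('k) - 1) = (of_nat CHAR('k) :: 'k witt)"
    by (metis Suc_diff_1 of_nat_Suc)
  show s: "dwork_shift (1 :: 'k witt) = CHAR('k) - 1"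
    by (rule dwork_shift_eqI) (use \<open>CHAR('k) > 0\<close> 1 in simp_all)
  show "dwork_prime (1 :: 'k witt) = 1"
    by (rule dwork_prime_eqI) (simp only: s 1 mult_1_right)
qed

lemma pochhammer_1_dwork_block:
  assumes "q < CHAR('k)"
  shows "pochhammer 1 (q + CHAR('k) * m) = strip_pochhammer CHAR('k) 1 (q + CHAR('k) * m) *
    (of_nat CHAR('k) ^ m * pochhammer (1 :: 'k::{alg_closed_field, field_prime_char} witt) m)"
proof -
  have "\<not> CHAR('k) - 1 < q" using assms by simp
  thus ?thesis
    using pochhammer_dwork_block[OF one_padic_int, of q m, where ?'k = 'k] assms
    by (simp add: dwork_shift_1 dwork_prime_1)
qed

lemma strip_pochhammer_unit:
  fixes a :: "'k::{alg_closed_field, field_prime_char} witt"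
  shows "strip_pochhammer CHAR('k) a k dvd 1"
proof (induction k)
  case (Suc k)
  have "strip CHAR('k) (a + of_nat k) dvd 1"
    unfolding strip_def using witt_unit by auto
  with Suc show ?case
    unfolding strip_pochhammer_Suc using mult_dvd_mono[of _ 1 _ 1] by fastforce
qed simp

section \<open>Integrality of the hypergeometric coefficients\<close>

text \<open>
  Write $k = q + pm$ with $q < p$.  Up to units, the factorisations replace $(1)_k$, $(2a)_k$ and
  $(a)_k$ by $p^m (1)_m$, $p^c (2a')_c$ and $p^d (a')_d$, where $c$ is $m$ or $m + 1$ according as
  $q \le 2l$ or not, and $d$ is $m$ or $m + 1$ according as $q \le l$ or not (for $k + 1$ the
  conditions are $q < 2l$ and $q < l$); in particular $c \le d$.  For $c = m + 1$ the first
  divisibility for $m$ does not suffice, because the denominator has the additional factor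
  $2a' + m$.  The second divisibility covers this case and is reproduced by the same induction step.
\<close>

lemma pochhammer_sq_dvd:
  fixes a :: "'k::{alg_closed_field, field_prime_char} witt"
  assumes "digit_dominated a"
  shows "pochhammer 1 k * pochhammer (2 * a) k dvd pochhammer a k ^ 2"
    "pochhammer 1 k * pochhammer (2 * a) (Suc k) dvd pochhammer a (Suc k) ^ 2"
proof -
  let ?p = "of_nat CHAR('k) :: 'k witt"
  have "pochhammer 1 k * pochhammer (2 * a) k dvd pochhammer a k ^ 2 \<and>
    pochhammer 1 k * pochhammer (2 * a) (Suc k) dvd pochhammer a (Suc k) ^ 2"
    using assms
  proof (induction k arbitrary: a rule: less_induct)
    case (less k)
    note props = digit_dominated_props[OF less.prems]
    define l b q m where "l = dwork_shift a" and "b = dwork_prime a"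
      and "q = k mod CHAR('k)" and "m = k div CHAR('k)"
    have l: "l > 0" "dwork_shift (2 * a) = 2 * l" "dwork_prime (2 * a) = 2 * b"
      using props by (simp_all add: l_def b_def)
    have "CHAR('k) > l" unfolding l_def by (rule dwork_shift_props(1)[OF props(1)])
    hence p: "CHAR('k) > 1" using l(1) by simp
    hence k: "k = q + CHAR('k) * m" "q < CHAR('k)" by (simp_all add: q_def m_def)
    \<comment> \<open>For $k = 0$ also $m = 0$, where the first divisibility is trivial; the second one is called upon only for $q > 0$.\<close>
    have "m < k" if "k > 0" using that p by (simp add: m_def)
    hence IH1: "pochhammer 1 m * pochhammer (2 * b) m dvd pochhammer b m ^ 2"
      using less.IH[of m b] props(5) by (cases "k = 0") (auto simp: b_def m_def)
    have IH2: "pochhammer 1 m * pochhammer (2 * b) (Suc m) dvd pochhammer b (Suc m) ^ 2" if "q > 0"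
      using less.IH[of m b] props(5) \<open>k > 0 \<Longrightarrow> m < k\<close> that k by (auto simp: b_def)
    \<comment> \<open>In both divisibilities $c \<le> d$, so $(2a')_c$ is compared with $(a')_c$ and then with $(a')_d$.\<close>
    have core: "(?p ^ m * pochhammer 1 m) * (?p ^ c * pochhammer (2 * b) c) dvd (?p ^ d * pochhammer b d) ^ 2"
      if "m \<le> d" "c \<le> d" "c = m \<or> (c = Suc m \<and> q > 0)" "d = m \<or> d = Suc m" for c d
    proof -
      have "?p ^ (m + c) dvd ?p ^ (2 * d)" using that by (intro le_imp_power_dvd) auto
      moreover have "pochhammer 1 m * pochhammer (2 * b) c dvd pochhammer b d ^ 2"
      proof -
        have "pochhammer 1 m * pochhammer (2 * b) c dvd pochhammer b c ^ 2"
          using that(3) IH1 IH2 by auto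
        moreover have "pochhammer b c dvd pochhammer b d"
          using that by (auto simp: pochhammer_Suc)
        ultimately show ?thesis using dvd_trans dvd_power_same by blast
      qed
      ultimately have "?p ^ (m + c) * (pochhammer 1 m * pochhammer (2 * b) c) dvd ?p ^ (2 * d) * pochhammer b d ^ 2"
        by (rule mult_dvd_mono)
      thus ?thesis by (simp add: power_mult_distrib power_add mult_ac flip: power_mult)
    qed
    have scale: "(u * x) * (v * y) dvd (w * z) ^ 2" if "u dvd 1" "v dvd 1" "x * y dvd z ^ 2"
      for u v w x y z :: "'k witt"
    proof -
      have "u * v dvd 1 * 1" using that by (intro mult_dvd_mono)
      hence "u * v dvd w ^ 2" by (metis dvd_trans mult_1 one_dvd)
      from mult_dvd_mono[OF this that(3)] show ?thesis by (simp add: power_mult_distrib mult_ac)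
    qed
    have one: "pochhammer 1 k = strip_pochhammer CHAR('k) 1 k * (?p ^ m * pochhammer 1 m)"
      unfolding k(1) by (rule pochhammer_1_dwork_block[OF k(2)])
    have A: "pochhammer a k = strip_pochhammer CHAR('k) a k *
        (?p ^ c * pochhammer b c)" if "c = (if l < q then Suc m else m)" for c
      unfolding that unfolding k(1) l_def b_def
      by (rule pochhammer_dwork_block[OF props(1)]) (use k(2) in simp)
    have A2: "pochhammer (2 * a) k = strip_pochhammer CHAR('k) (2 * a) k *
        (?p ^ c * pochhammer (2 * b) c)" if "c = (if 2 * l < q then Suc m else m)" for c
      unfolding that unfolding k(1) l(2,3)[symmetric]
      by (rule pochhammer_dwork_block[OF double_padic_int[OF props(1)]]) (use k(2) in simp)
    have Sk: "Suc k = Suc q + CHAR('k) * m" "Suc q \<le> CHAR('k)" using k by simp_all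
    have AS: "pochhammer a (Suc k) = strip_pochhammer CHAR('k) a (Suc k) *
        (?p ^ c * pochhammer b c)" if "c = (if l < Suc q then Suc m else m)" for c
      unfolding that unfolding Sk(1) l_def b_def
      by (rule pochhammer_dwork_block[OF props(1) Sk(2)])
    have A2S: "pochhammer (2 * a) (Suc k) = strip_pochhammer CHAR('k) (2 * a) (Suc k) *
        (?p ^ c * pochhammer (2 * b) c)" if "c = (if 2 * l < Suc q then Suc m else m)" for c
      unfolding that unfolding Sk(1) l(2,3)[symmetric]
      by (rule pochhammer_dwork_block[OF double_padic_int[OF props(1)] Sk(2)])
    note unit = strip_pochhammer_unit
    have "pochhammer 1 k * pochhammer (2 * a) k dvd pochhammer a k ^ 2"
      unfolding one A[OF refl] A2[OF refl]
      by (rule scale[OF unit unit core]) (use l(1) in auto)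
    moreover have "pochhammer 1 k * pochhammer (2 * a) (Suc k) dvd pochhammer a (Suc k) ^ 2"
      unfolding one AS[OF refl] A2S[OF refl]
      by (rule scale[OF unit unit core]) (use l(1) in auto)
    ultimately show ?case by blast
  qed
  thus "pochhammer 1 k * pochhammer (2 * a) k dvd pochhammer a k ^ 2"
    "pochhammer 1 k * pochhammer (2 * a) (Suc k) dvd pochhammer a (Suc k) ^ 2" by blast+
qed

lemma pochhammer_nonzero:
  fixes a :: "'k::{alg_closed_field, field_prime_char} witt"
  assumes "\<And>i. a + of_nat i \<noteq> 0"
  shows "pochhammer a k \<noteq> 0"
  using assms by (induction k) (auto simp: pochhammer_Suc)

lemma of_nat_witt_nonzero:
  assumes "n > 0"
  shows "(of_nat n :: 'k::{alg_closed_field, field_prime_char} witt) \<noteq> 0"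
proof
  assume "(of_nat n :: 'k witt) = 0"
  hence "(of_nat CHAR('k) :: 'k witt) ^ n dvd of_int (int n)" by simp
  hence "CHAR('k) ^ n dvd n"
    unfolding CHAR_power_dvd_of_int_witt_iff by (metis of_nat_dvd_iff of_nat_power)
  hence "CHAR('k) ^ n \<le> n" using assms by (rule dvd_imp_le)
  moreover have "n < CHAR('k) ^ n"
    using prime_gt_1_nat[of "CHAR('k)"] by (intro power_gt_expt) simp_all
  ultimately show False by simp
qed

lemma pochhammer_denominator_nonzero:
  fixes a :: "'k::{alg_closed_field, field_prime_char} witt"
  assumes "digit_dominated a"
  shows "pochhammer 1 k * pochhammer (2 * a) k \<noteq> 0"
proof -
  have "1 + of_nat i \<noteq> (0 :: 'k witt)" for i
    using of_nat_witt_nonzero[of "Suc i", where ?'k = 'k] by simp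
  thus ?thesis
    using pochhammer_nonzero[of "1 :: 'k witt" k] pochhammer_nonzero[of "2 * a" k] add_of_nat_nonzero[OF assms]
    by simp
qed

text \<open>
  The coefficient $A_k$ as an element of $W$, which permits congruences between coefficients.
\<close>

definition witt_hyp_coeff :: "'k::{alg_closed_field, field_prime_char} witt \<Rightarrow> nat \<Rightarrow> 'k witt" where
  "witt_hyp_coeff a k = (SOME A. pochhammer a k ^ 2 = pochhammer 1 k * pochhammer (2 * a) k * A)"

lemma witt_hyp_coeff:
  assumes "digit_dominated a"
  shows "pochhammer a k ^ 2 = pochhammer 1 k * pochhammer (2 * a) k * witt_hyp_coeff a k"
  unfolding witt_hyp_coeff_def by (rule someI_ex) (use pochhammer_sq_dvd(1)[OF assms, of k] in \<open>unfold dvd_def\<close>)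

lemma to_fract_of_nat: "to_fract (of_nat n) = of_nat n"
  by (induction n) simp_all

lemma to_fract_pochhammer: "to_fract (pochhammer x n) = pochhammer (to_fract x) n"
  by (induction n) (simp_all add: pochhammer_Suc to_fract_of_nat)

lemma to_fract_power: "to_fract (x ^ n) = to_fract x ^ n"
  by (induction n) simp_all

lemma hyp_coeff_eq:
  fixes a :: "'k::{alg_closed_field, field_prime_char} witt"
  assumes "digit_dominated a"
  shows "fps_nth (hyp a a (2 * a)) k = to_fract (witt_hyp_coeff a k)"
proof -
  have "to_fract (pochhammer 1 k * pochhammer (2 * a) k) \<noteq> 0"
    using pochhammer_denominator_nonzero[OF assms] by (simp only: to_fract_eq_0_iff) simp
  moreover have "fps_nth (hyp a a (2 * a)) k =
      to_fract (pochhammer a k ^ 2) / to_fract (pochhammer 1 k * pochhammer (2 * a) k)"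
    by (simp add: hypergeom_def to_fract_pochhammer power2_eq_square del: to_fract_eq_iff)
  ultimately show ?thesis
    unfolding witt_hyp_coeff[OF assms] to_fract_mult[of _ "witt_hyp_coeff a k"] by simp
qed

section \<open>The congruence between the coefficients for $a$ and $a'$\<close>

lemma of_int_morita:
  "(- 1) ^ m * of_nat (\<Prod>i | 0 < i \<and> i < m \<and> \<not> p dvd i. i) = (of_int (morita p m) :: 'a::comm_ring_1)"
proof -
  have "strip_pochhammer p (0::int) m = (\<Prod>i | 0 < i \<and> i < m \<and> \<not> p dvd i. int i)"
    unfolding strip_pochhammer_def
    by (rule prod.mono_neutral_cong_right) (auto simp: strip_def intro: Nat.gr0I)
  thus ?thesis by (simp add: morita_def)
qed

lemma padic_Gamma_cong:
  fixes z :: "'k::{alg_closed_field, field_prime_char} witt"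
  assumes "odd CHAR('k)" "z \<in> padic_ints" "n \<ge> 1" "of_nat CHAR('k) ^ n dvd of_nat N - z"
  shows "of_nat CHAR('k) ^ n dvd of_int (morita CHAR('k) N) - padic_Gamma z"
  unfolding padic_Gamma_def of_int_morita
proof (rule padic_lim_cong[OF _ assms(2-4)])
  fix n i j :: nat assume "n \<ge> 1" "[i = j] (mod CHAR('k) ^ n)"
  hence "int CHAR('k) ^ n dvd morita CHAR('k) i - morita CHAR('k) j"
    using morita_cong[of "CHAR('k)"] assms(1) by (simp add: cong_iff_dvd_diff)
  from CHAR_power_dvd_of_int_witt[OF this]
  show "of_nat CHAR('k) ^ n dvd of_int (morita CHAR('k) i) - (of_int (morita CHAR('k) j) :: 'k witt)"
    by simp
qed

lemma padic_Gamma_unit: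
  fixes z :: "'k::{alg_closed_field, field_prime_char} witt"
  assumes "odd CHAR('k)" "z \<in> padic_ints"
  shows "padic_Gamma z dvd 1"
proof (rule witt_unit)
  obtain N where "of_nat CHAR('k) ^ 1 dvd of_nat N - z"
    using padic_ints_nat_approx[OF assms(2)] .
  from padic_Gamma_cong[OF assms _ this]
  have d: "of_nat CHAR('k) dvd of_int (morita CHAR('k) N) - padic_Gamma z" by simp
  have "prime (int CHAR('k))" by simp
  moreover have "coprime (morita CHAR('k) N) (int CHAR('k) ^ 1)"
    using coprime_strip_pochhammer[of "CHAR('k)" 0 N 1] by (simp add: morita_def)
  ultimately have "\<not> int CHAR('k) dvd morita CHAR('k) N"
    by (metis coprime_common_divisor dvd_refl not_prime_unit power_one_right)
  moreover have "int CHAR('k) dvd morita CHAR('k) N" if "of_nat CHAR('k) dvd padic_Gamma z"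
    using dvd_add[OF d that] CHAR_dvd_of_int_witt_iff[where ?'k = 'k] by simp
  ultimately show "\<not> of_nat CHAR('k) dvd padic_Gamma z" by blast
qed

lemma of_int_strip_pochhammer:
  "of_int (strip_pochhammer CHAR('k) m k) =
     strip_pochhammer CHAR('k) (of_int m :: 'k::{alg_closed_field, field_prime_char} witt) k"
proof (induction k)
  case (Suc k)
  have "strip CHAR('k) (of_int (m + int k) :: 'k witt) = of_int (strip CHAR('k) (m + int k))"
    by (rule strip_of_int[OF CHAR_dvd_of_int_witt_iff])
  thus ?case by (simp add: strip_pochhammer_Suc Suc)
qed simp

text \<open>
  Approximating $a$ by a natural number $N$ modulo $p^n$ changes no term modulo $p^n$, so the
  congruence for natural numbers carries over.
\<close>

lemma strip_pochhammer_Gamma_cong: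
  fixes a :: "'k::{alg_closed_field, field_prime_char} witt"
  assumes odd: "odd CHAR('k)" and a: "a \<in> padic_ints" and n: "n \<ge> 1"
    and k: "of_nat CHAR('k) ^ n dvd a + of_nat k"
  shows "of_nat CHAR('k) ^ n dvd (strip_pochhammer CHAR('k) a k * padic_Gamma a) ^ 2 -
    (- 1) ^ (k + k div CHAR('k)) * padic_Gamma (2 * a) *
      (strip_pochhammer CHAR('k) 1 k * strip_pochhammer CHAR('k) (2 * a) k)"
proof -
  let ?p = "of_nat CHAR('k) :: 'k witt" and ?S = "strip_pochhammer CHAR('k)"
  obtain N where N: "?p ^ n dvd of_nat N - a" using padic_ints_nat_approx[OF a] .
  have N2: "?p ^ n dvd of_nat (2 * N) - 2 * a"
    using dvd_mult[OF N, of 2] by (simp add: right_diff_distrib)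
  have "?p ^ n dvd of_int (int (N + k))" using dvd_add[OF N k] by simp
  hence Nk: "CHAR('k) ^ n dvd N + k"
    unfolding CHAR_power_dvd_of_int_witt_iff by (metis of_nat_dvd_iff of_nat_power)
  have sq: "q dvd x - y \<Longrightarrow> q dvd x ^ 2 - y ^ 2" for q x y :: "'k witt"
    unfolding power2_eq_square by (intro dvd_mult_diff)
  have "?p ^ n dvd ?S (of_nat N) k - ?S a k"
    by (rule strip_pochhammer_cong[OF N n])
  moreover have "?p ^ n dvd ?S (of_nat (2 * N)) k - ?S (2 * a) k"
    by (rule strip_pochhammer_cong[OF N2 n])
  moreover note padic_Gamma_cong[OF odd a n N] padic_Gamma_cong[OF odd double_padic_int[OF a] n N2]
  ultimately have c:
    "?p ^ n dvd (?S (of_nat N) k * of_int (morita CHAR('k) N)) ^ 2 - (?S a k * padic_Gamma a) ^ 2"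
    "?p ^ n dvd (- 1) ^ (k + k div CHAR('k)) * of_int (morita CHAR('k) (2 * N)) * (?S 1 k * ?S (of_nat (2 * N)) k) -
      (- 1) ^ (k + k div CHAR('k)) * padic_Gamma (2 * a) * (?S 1 k * ?S (2 * a) k)"
    by (auto intro!: sq dvd_mult_diff)
  have "int CHAR('k) ^ n dvd (?S (int N) k * morita CHAR('k) N) ^ 2 -
     (- 1) ^ (k + k div CHAR('k)) * morita CHAR('k) (2 * N) * (?S 1 k * ?S (2 * int N) k)"
    using strip_pochhammer_gamma_cong[OF _ odd n Nk] by (simp add: cong_iff_dvd_diff)
  from CHAR_power_dvd_of_int_witt[OF this]
  have "?p ^ n dvd (?S (of_nat N) k * of_int (morita CHAR('k) N)) ^ 2 -
     (- 1) ^ (k + k div CHAR('k)) * of_int (morita CHAR('k) (2 * N)) * (?S 1 k * ?S (of_nat (2 * N)) k)"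
    by (simp add: of_int_strip_pochhammer)
  from dvd_diff_trans[OF dvd_diff_trans[OF dvd_diff_sym[OF c(1)] this] c(2)] show ?thesis .
qed

text \<open>
  For $k = l + pm$ each of the three Pochhammer symbols has exactly $m$ multiples of $p$ among its
  factors, so the powers of $p$ cancel and only the products of units remain.
\<close>

lemma witt_hyp_coeff_cong:
  fixes a :: "'k::{alg_closed_field, field_prime_char} witt"
  assumes odd: "odd CHAR('k)" and a: "digit_dominated a" and n: "n \<ge> 1"
    and k: "k = dwork_shift a + CHAR('k) * m" and dvd: "of_nat CHAR('k) ^ n dvd a + of_nat k"
  shows "of_nat CHAR('k) ^ n dvd witt_hyp_coeff a k * padic_Gamma a ^ 2 -
    (- 1) ^ dwork_shift a * padic_Gamma (2 * a) * witt_hyp_coeff (dwork_prime a) m"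
proof -
  note props = digit_dominated_props[OF a]
  let ?p = "of_nat CHAR('k) :: 'k witt" and ?S = "strip_pochhammer CHAR('k)"
  let ?l = "dwork_shift a" and ?b = "dwork_prime a"
  have l: "?l < CHAR('k)" by (rule dwork_shift_props(1)[OF props(1)])
  define D where "D = pochhammer 1 m * pochhammer (2 * ?b) m"
  define U where "U = ?S 1 k * ?S (2 * a) k"
  have "pochhammer a k = ?S a k * (?p ^ m * pochhammer ?b m)"
    using pochhammer_dwork_block[OF props(1), of ?l m] l by (simp add: k)
  moreover have "pochhammer (2 * a) k = ?S (2 * a) k * (?p ^ m * pochhammer (2 * ?b) m)"
    using pochhammer_dwork_block[OF double_padic_int[OF props(1)], of ?l m] l
    by (simp add: k props(3,4))
  moreover have "pochhammer 1 k = ?S 1 k * (?p ^ m * pochhammer 1 m)"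
    using pochhammer_1_dwork_block[OF l, of m] by (simp add: k)
  ultimately have "(?S a k * (?p ^ m * pochhammer ?b m)) ^ 2 =
      (?S 1 k * (?p ^ m * pochhammer 1 m)) * (?S (2 * a) k * (?p ^ m * pochhammer (2 * ?b) m)) * witt_hyp_coeff a k"
    using witt_hyp_coeff[OF a, of k] by metis
  hence "(?p ^ m) ^ 2 * (?S a k ^ 2 * pochhammer ?b m ^ 2) = (?p ^ m) ^ 2 * (U * D * witt_hyp_coeff a k)"
    by (simp add: power_mult_distrib power2_eq_square U_def D_def mult_ac)
  hence "?S a k ^ 2 * pochhammer ?b m ^ 2 = U * D * witt_hyp_coeff a k"
    using of_nat_CHAR_witt_nonzero[where ?'k = 'k] by simp
  also have "pochhammer ?b m ^ 2 = D * witt_hyp_coeff ?b m"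
    unfolding D_def by (rule witt_hyp_coeff[OF props(5)])
  finally have "D * (?S a k ^ 2 * witt_hyp_coeff ?b m) = D * (U * witt_hyp_coeff a k)"
    by (simp add: mult_ac)
  hence eq: "?S a k ^ 2 * witt_hyp_coeff ?b m = U * witt_hyp_coeff a k"
    using pochhammer_denominator_nonzero[OF props(5), of m] by (simp add: D_def)
  have "k div CHAR('k) = m" using l by (simp add: k)
  hence "(- 1) ^ (k + k div CHAR('k)) = (- 1 :: 'k witt) ^ ?l"
    using odd by (simp add: k power_add power_mult flip: power_mult_distrib)
  hence "?p ^ n dvd (?S a k * padic_Gamma a) ^ 2 - (- 1) ^ ?l * padic_Gamma (2 * a) * U"
    using strip_pochhammer_Gamma_cong[OF odd props(1) n dvd] by (simp add: U_def)
  hence "?p ^ n dvd ((?S a k * padic_Gamma a) ^ 2 - (- 1) ^ ?l * padic_Gamma (2 * a) * U) * witt_hyp_coeff ?b m"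
    by (rule dvd_mult2)
  also have "\<dots> = (?S a k ^ 2 * witt_hyp_coeff ?b m) * padic_Gamma a ^ 2
       - (- 1) ^ ?l * padic_Gamma (2 * a) * U * witt_hyp_coeff ?b m"
    by (simp add: algebra_simps power_mult_distrib)
  also have "\<dots> = U * (witt_hyp_coeff a k * padic_Gamma a ^ 2 -
      (- 1) ^ ?l * padic_Gamma (2 * a) * witt_hyp_coeff ?b m)"
    unfolding eq by (simp add: algebra_simps)
  finally have *: "?p ^ n dvd U * (witt_hyp_coeff a k * padic_Gamma a ^ 2 -
      (- 1) ^ ?l * padic_Gamma (2 * a) * witt_hyp_coeff ?b m)" .
  have "U dvd 1 * 1"
    unfolding U_def by (intro mult_dvd_mono strip_pochhammer_unit)
  then obtain V where V: "V * U = 1" by (metis dvdE mult.commute mult_1)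
  from dvd_mult[OF *, of V] show ?thesis by (simp only: mult.assoc[symmetric] V mult_1)
qed

section \<open>The coefficients of $\widehat G$\<close>

lemma integral_fps_divide:
  fixes f g :: "'k::{alg_closed_field, field_prime_char} witt fract fps"
  assumes f: "f \<in> integral_fps" and g: "g \<in> integral_fps" and g0: "fps_nth g 0 = 1"
  shows "f / g \<in> integral_fps"
proof -
  define h where "h = f / g"
  have "h * g = f"
    unfolding h_def using g0 by (simp add: fps_divide_unit mult.assoc inverse_mult_eq_1)
  have "fps_nth h n \<in> range to_fract" for n
  proof (induction n rule: less_induct)
    case (less n)
    have "fps_nth f n = (\<Sum>i\<le>n. fps_nth h i * fps_nth g (n - i))"
      unfolding \<open>h * g = f\<close>[symmetric] by (simp add: fps_mult_nth atMost_atLeast0)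
    also have "\<dots> = (\<Sum>i<n. fps_nth h i * fps_nth g (n - i)) + fps_nth h n"
      by (simp add: g0 flip: lessThan_Suc_atMost)
    finally have hn: "fps_nth h n = fps_nth f n - (\<Sum>i<n. fps_nth h i * fps_nth g (n - i))" by simp
    have "\<forall>i. i < n \<longrightarrow> (\<exists>x. fps_nth h i = to_fract x)" using less by blast
    then obtain H where H: "\<And>i. i < n \<Longrightarrow> fps_nth h i = to_fract (H i)" by metis
    have "\<forall>i. \<exists>x. fps_nth g i = to_fract x" using g unfolding integral_fps_def by blast
    then obtain G where G: "\<And>i. fps_nth g i = to_fract (G i)" by metis
    obtain x where x: "fps_nth f n = to_fract x" using f unfolding integral_fps_def by blast
    have "fps_nth h n = to_fract (x - (\<Sum>i<n. H i * G (n - i)))"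
      unfolding hn x by (simp add: H G)
    thus ?case by blast
  qed
  thus ?thesis unfolding integral_fps_def h_def by blast
qed

text \<open>
  Here $k + a = p^n u$ with a unit $u$.  For $n = 0$ nothing is to be shown.  For $n > 0$ the
  numerator splits into the difference $A_k - (-1)^l B_p(a,a)^{-1} A^{(1)}_m$ and a multiple of
  $c^{(k+a)/p} - 1$, both divisible by $p^n$.
\<close>

lemma G_hat_coeff_integral:
  fixes a c :: "'k::{alg_closed_field, field_prime_char} witt"
  assumes odd: "odd CHAR('k)" and a: "digit_dominated a" and c: "of_nat CHAR('k) dvd c - 1"
  shows "fps_nth (G_hat c a) k \<in> range to_fract"
proof -
  note props = digit_dominated_props[OF a]
  let ?p = "of_nat CHAR('k) :: 'k witt"
  let ?l = "dwork_shift a" and ?b = "dwork_prime a"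
  let ?m = "(k - ?l) div CHAR('k)"
  define e where "e = (THE e. ?p * e = of_nat k + a)"
  obtain g where g: "padic_Gamma a * g = 1"
    using padic_Gamma_unit[OF odd props(1)] by (metis dvdE)
  have "to_fract (padic_Gamma a) * to_fract g = 1" using g by (metis to_fract_1 to_fract_mult)
  hence g': "inverse (to_fract (padic_Gamma a)) = to_fract g" by (rule inverse_unique)
  have beta: "inverse (padic_Beta a a) = to_fract (padic_Gamma (2 * a) * g ^ 2)"
    by (simp add: padic_Beta_def g' to_fract_power power2_eq_square divide_inverse mult_ac flip: mult_2)
  define numer where "numer = (if ?l \<le> k \<and> CHAR('k) dvd k - ?l then
      witt_hyp_coeff a k - (- 1) ^ ?l * padic_Gamma (2 * a) * g ^ 2 * (witt_hyp_coeff ?b ?m * padic_power c e)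
    else witt_hyp_coeff a k)"
  have G: "fps_nth (G_hat c a) k = to_fract numer / to_fract (a + of_nat k)"
    using G_hat_coeff[OF props(1), of c k]
    unfolding props(4) hyp_coeff_eq[OF a] hyp_coeff_eq[OF props(5)] beta e_def[symmetric]
    by (simp add: numer_def to_fract_power to_fract_of_nat add.commute mult_ac)
  have nz: "a + of_nat k \<noteq> 0" using add_of_nat_nonzero[OF a] by blast
  have "a + of_nat k dvd numer"
  proof (cases "?p dvd a + of_nat k")
    case False
    thus ?thesis using witt_unit dvd_trans one_dvd by blast
  next
    case True
    hence d: "int CHAR('k) dvd int k - int ?l"
      by (simp only: CHAR_dvd_padic_add_of_nat_iff[OF props(1)])
    have l: "?l < CHAR('k)" by (rule dwork_shift_props(1)[OF props(1)])
    have "?l \<le> k"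
    proof (rule ccontr)
      assume "\<not> ?l \<le> k"
      hence "0 < int ?l - int k" "int ?l - int k < int CHAR('k)" using l by auto
      moreover have "int CHAR('k) dvd int ?l - int k" using dvd_diff_sym[OF d] .
      ultimately show False using zdvd_not_zless by blast
    qed
    hence d': "CHAR('k) dvd k - ?l" using d by (metis of_nat_diff of_nat_dvd_iff)
    have k: "k = ?l + CHAR('k) * ?m" using \<open>?l \<le> k\<close> d' by simp
    have pe: "?p * (?b + of_nat ?m) = of_nat k + a"
    proof -
      have "of_nat k = of_nat ?l + ?p * (of_nat ?m :: 'k witt)" by (metis k of_nat_add of_nat_mult)
      thus ?thesis by (simp only: distrib_left dwork_prime_eq[OF props(1)] add_ac)
    qed
    have e: "e = ?b + of_nat ?m"
      unfolding e_def
    proof (rule the_equality, rule pe)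
      fix e' assume "?p * e' = of_nat k + a"
      hence "?p * e' = ?p * (?b + of_nat ?m)" using pe by simp
      thus "e' = ?b + of_nat ?m"
        using of_nat_CHAR_witt_nonzero[where ?'k = 'k] mult_left_cancel by blast
    qed
    have e_int: "e \<in> padic_ints"
      unfolding e by (intro padic_ints_closed dwork_prime_padic_int props(1) of_nat_padic_int)
    obtain n u where nu: "a + of_nat k = ?p ^ n * u" "witt_coeff u 0 \<noteq> 0"
      using witt_factor[OF nz] .
    have u: "u dvd 1"
      using witt_unit[of u] CHAR_power_dvd_witt_iff[of 1 u] nu(2) by auto
    have "n \<noteq> 0"
    proof
      assume "n = 0"
      hence "?p ^ 1 dvd u" using True nu(1) by simp
      thus False using nu(2) unfolding CHAR_power_dvd_witt_iff by blast
    qed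
    then obtain n' where n': "n = Suc n'" by (cases n) auto
    have "?p * e = ?p * (?p ^ n' * u)" using pe nu(1) by (simp add: e n' add.commute mult_ac)
    hence "e = ?p ^ n' * u"
      using of_nat_CHAR_witt_nonzero[where ?'k = 'k] mult_left_cancel by blast
    hence C: "?p ^ n dvd padic_power c e - 1"
      unfolding n' by (intro padic_power_cong_1 c e_int) simp
    let ?G = "padic_Gamma a" and ?Y = "(- 1) ^ ?l * padic_Gamma (2 * a) * witt_hyp_coeff ?b ?m"
    have A: "?p ^ n dvd witt_hyp_coeff a k * ?G ^ 2 - ?Y"
      using witt_hyp_coeff_cong[OF odd a _ k, of n] nu(1) n' by simp
    have "numer = witt_hyp_coeff a k * (?G * g) ^ 2 - g ^ 2 * ?Y * padic_power c e"
      unfolding g using \<open>?l \<le> k\<close> d' by (simp add: numer_def mult_ac)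
    also have "\<dots> = g ^ 2 * (witt_hyp_coeff a k * ?G ^ 2 - ?Y) - g ^ 2 * ?Y * (padic_power c e - 1)"
      by (simp add: algebra_simps power_mult_distrib)
    finally have "?p ^ n dvd numer" using A C by (simp add: dvd_diff)
    from mult_dvd_mono[OF this u] show ?thesis unfolding nu(1) by simp
  qed
  then obtain B where "numer = (a + of_nat k) * B" by (elim dvdE)
  hence "fps_nth (G_hat c a) k = to_fract (a + of_nat k) * to_fract B / to_fract (a + of_nat k)"
    unfolding G by (simp only: to_fract_mult)
  also have "\<dots> = to_fract B"
    using nz by (metis nonzero_mult_div_cancel_left to_fract_eq_0_iff)
  finally show ?thesis by simp
qed

theorem lemma4p3:
  fixes a c :: "'p::prime_card W"
  assumes p: "CARD('p) \<ge> 3"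
    and a: "a \<in> padic_ints"
    and a1: "\<exists>N::nat. N \<ge> 2 \<and> \<not> CARD('p) dvd N \<and> of_nat N * a \<in> \<int>"
    and a2: "\<forall>i. padic_digit a i < padic_digit (2 * a) i"
    and c: "of_nat CARD('p) dvd c - 1"
  shows "(\<forall>k. fps_nth (G_hat c a) k \<in> range to_fract) \<and> F_hat c a \<in> integral_fps"
proof -
  note char = CHAR_mod_ring_alg_closure[where ?'p = 'p]
  have "prime CHAR('p mod_ring alg_closure)" by (rule prime_CHAR_semidom) (use p in simp)
  hence odd: "odd CHAR('p mod_ring alg_closure)"
    using p prime_odd_nat[of "CARD('p)"] by (simp only: char) simp
  have dom: "digit_dominated a" using a a2 by (simp add: digit_dominated_def)
  have G: "fps_nth (G_hat c a) k \<in> range to_fract" for k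
    by (rule G_hat_coeff_integral[OF odd dom]) (use c in \<open>simp only: char\<close>)
  have "hyp a a (2 * a) \<in> integral_fps"
    unfolding integral_fps_def using hyp_coeff_eq[OF dom] by auto
  moreover have "fps_nth (hyp a a (2 * a)) 0 = 1" by (simp add: hypergeom_def)
  ultimately have "F_hat c a \<in> integral_fps"
    unfolding F_hat_def using G by (intro integral_fps_divide) (auto simp: integral_fps_def)
  with G show ?thesis by blast
qed

end
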